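(* There is a function $\varepsilon\colon\mathbb{N}\to[0,\infty)$ with $\varepsilon(n)\to 0$ as $n\to\infty$ such that for every $n$ there exists a unit ball covering $P$ of $\mathbb{R}^n$ with \[ \vartheta(P)\le\Big(\tfrac12+\varepsilon(n)\Big)\,n\ln n\qquad\text{and}\qquad \mu(P)\le\big(\xi+\varepsilon(n)\big)\,n\ln n, \] where $\xi=1.79556\ldots$ is the unique positive real root of $\ln\!\left(\frac{2x}{\mathrm{e}}\right)=\frac{1}{2x}$.
   Context: For $\mathbf{x}\in\mathbb{R}^n$ and $r>0$, $B_r^n(\mathbf{x})=\{\mathbf{y}\in\mathbb{R}^n:\|\mathbf{x}-\mathbf{y}\|\le r\}$ (Euclidean norm), $B_r^n=B_r^n(\mathbf{0})$. A discrete set $P\subseteq\mathbb{R}^n$ is a unit ball covering of $\mathbb{R}^n$ if $\mathbb{R}^n\subseteq P+B_1^n=\{\mathbf{p}+\mathbf{x}:\mathbf{p}\in P,\mathbf{x}\in B_1^n\}$. For measurable $A$ of finite positive measure, $\vartheta(P,A)=\sum_{\mathbf{p}\in P}\operatorname{vol}(A\cap(B_1^n+\mathbf{p}))/\operatorname{vol}(A)$, and $\vartheta(P)=\limsup_{r\to\infty}\vartheta(P,[-r,r]^n)$ is the covering density. For $\mathbf{x}\in\mathbb{R}^n$, $\mu(P,\mathbf{x})=|\{\mathbf{p}\in P:\mathbf{x}\in B_1^n+\mathbf{p}\}|$, and $\mu(P)=\sup_{\mathbf{x}\in\mathbb{R}^n}\mu(P,\mathbf{x})$ is the covering multiplicit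y.
   Formalization: "For every n" is taken as every n ≥ 2: for n = 1 the bound n ln n is 0 while every unit ball covering has density and multiplicity at least 1, so the claim fails there (and ln 0 is undefined for n = 0). *)

theory Defs
  imports "HOL-Analysis.Analysis"
begin

(* The dimension n is quantified inside the statement, so R^n cannot be the type real ^ 'n.
   A vector of R^n is an extensional function in PiE {..<n} (\<lambda>_. UNIV), the carrier of
   both the n-fold product topology and the n-fold product of Lebesgue-Borel measure.
   Extensional functions are not closed under pointwise + and -, so a translate
   B_1^n + p is written as the ball of radius 1 around p. *)

abbreviation rspace :: "nat \<Rightarrow> (nat \<Rightarrow> real) set" where
  "rspace n \<equiv> PiE {..<n} (\<lambda>_. UNIV)"

definition edist :: "nat \<Rightarrow> (nat \<Rightarrow> real) \<Rightarrow> (nat \<Rightarrow> real) \<Rightarrow> real" where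
  "edist n x y = L2_set (\<lambda>i. x i - y i) {..<n}"

definition eball :: "nat \<Rightarrow> real \<Rightarrow> (nat \<Rightarrow> real) \<Rightarrow> (nat \<Rightarrow> real) set" where
  "eball n r x = {y \<in> rspace n. edist n x y \<le> r}"

definition cube :: "nat \<Rightarrow> real \<Rightarrow> (nat \<Rightarrow> real) set" where
  "cube n r = PiE {..<n} (\<lambda>_. {- r..r})"

definition vol :: "nat \<Rightarrow> (nat \<Rightarrow> real) set \<Rightarrow> ennreal" where
  "vol n A = emeasure (PiM {..<n} (\<lambda>_. lborel)) A"

definition discrete_in :: "nat \<Rightarrow> (nat \<Rightarrow> real) set \<Rightarrow> bool" where
  "discrete_in n P \<longleftrightarrow>
     subtopology (product_topology (\<lambda>_. euclideanreal) {..<n}) P = discrete_topology P"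

definition unit_ball_covering :: "nat \<Rightarrow> (nat \<Rightarrow> real) set \<Rightarrow> bool" where
  "unit_ball_covering n P \<longleftrightarrow>
     P \<subseteq> rspace n \<and> discrete_in n P \<and> rspace n \<subseteq> (\<Union>p\<in>P. eball n 1 p)"

definition density_on :: "nat \<Rightarrow> (nat \<Rightarrow> real) set \<Rightarrow> (nat \<Rightarrow> real) set \<Rightarrow> ennreal" where
  "density_on n P A = (\<Sum>\<^sub>\<infinity>p\<in>P. vol n (A \<inter> eball n 1 p)) / vol n A"

definition covering_density :: "nat \<Rightarrow> (nat \<Rightarrow> real) set \<Rightarrow> ennreal" where
  "covering_density n P = Limsup at_top (\<lambda>r. density_on n P (cube n r))"

(* Cardinalities are counting measures, so that an infinite set counts as \<infinity>
   (card would give 0). *)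

definition multiplicity_at :: "nat \<Rightarrow> (nat \<Rightarrow> real) set \<Rightarrow> (nat \<Rightarrow> real) \<Rightarrow> ennreal" where
  "multiplicity_at n P x = emeasure (count_space UNIV) {p \<in> P. x \<in> eball n 1 p}"

definition covering_multiplicity :: "nat \<Rightarrow> (nat \<Rightarrow> real) set \<Rightarrow> ennreal" where
  "covering_multiplicity n P = (SUP x\<in>rspace n. multiplicity_at n P x)"

definition is_xi :: "real \<Rightarrow> bool" where
  "is_xi x \<longleftrightarrow> 0 < x \<and> ln (2 * x / exp 1) = 1 / (2 * x)"

definition xi :: real where
  "xi = (THE x. is_xi x)"

end

theory Submission
  imports Defs
begin

text \<open>
  A lattice \<open>\<Lambda> \<subseteq> \<int>\<^sup>n\<close> of index \<open>p\<^bsup>n-1\<^esup>\<close> without short nonzero vectors exists by averaging over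
  \<open>{x. x\<^sub>i \<equiv> a\<^sub>i x\<^sub>0 (mod p)}\<close>. With \<open>R\<close> such that the index is \<open>4\<^sup>n\<close> times the volume of a ball of radius
  \<open>R\<close>, this ball embeds into the torus \<open>\<int>\<^sup>n/\<Lambda>\<close>, whose volume is only exponentially larger; therefore a
  plain union bound over a net of the torus suffices, without the Local Lemma. Choose
  \<open>(1/2 + \<epsilon>) n ln n\<close> balls per ball volume independently at random in the torus.

  Multiplicity: at each of the \<open>O(n)\<^sup>n\<close> points of a net of spacing about \<open>R/n\<close>, the Chernoff bound with
  parameter \<open>2\<xi>\<close> makes more than \<open>(\<xi> + 10\<epsilon>) n ln n\<close> hits less likely than \<open>n\<^bsup>-n\<^esup>\<close>; the equation of \<open>\<xi>\<close>
  says precisely that the exponents match.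

  Covering: around each of the \<open>O(\<surd>n)\<^sup>n\<close> points \<open>t\<close> of a coarse net of spacing about \<open>R/\<surd>n\<close> there are, up to
  probability less than \<open>n\<^bsup>-n/2\<^esup>\<close>, at least \<open>\<rho> n ln n\<close> centres; this is where the constant \<open>1/2\<close> comes from.
  All but a small proportion \<open>\<eta>\<close> of the ball around \<open>t\<close> lies in the slightly smaller ball around any fine net
  point near \<open>t\<close>, so the probability that none of these centres covers that point is at most
  \<open>\<eta>\<close> to the power \<open>\<rho> n ln n\<close>, which beats the number of fine net points.
\<close>

section \<open>The constant and the exponents\<close>

lemma is_xi_iff: "is_xi x \<longleftrightarrow> 0 < x \<and> ln (2 * x) - 1 - 1 / (2 * x) = 0"
  by (auto simp: is_xi_def ln_div)

lemma xi_fun_strict_mono: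
  fixes x y :: real
  assumes "0 < x" "x < y"
  shows "ln (2 * x) - 1 - 1 / (2 * x) < ln (2 * y) - 1 - 1 / (2 * y)"
proof -
  have "ln (2 * x) < ln (2 * y)" using assms by simp
  moreover have "1 / (2 * y) < 1 / (2 * x)" using assms by (simp add: field_simps)
  ultimately show ?thesis by linarith
qed

lemma ln_two_bounds: "ln (2::real) \<in> {0.69314716..0.69314720}"
  using ln_approx_bounds[of 2 8] by (simp add: eval_nat_numeral)

lemma ln_nine_fifths_bounds: "ln (9 / 5 :: real) \<in> {0.58778664..0.58778668}"
  using ln_approx_bounds[of "9 / 5" 7] by (simp add: eval_nat_numeral)

text \<open>Both ratios are so close to 1 that truncating the logarithm series after a single term
  gives enough digits.\<close>

lemma ln_18_div_bounds:
  "0.0024697 \<le> ln (1.8 / 1.79556 :: real)" "ln (1.8 / 1.79557 :: real) \<le> 0.0024643"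
  using ln_approx_bounds[of "1.8 / 1.79556" 1] ln_approx_bounds[of "1.8 / 1.79557" 1]
  by (simp_all add: eval_nat_numeral)

text \<open>Together with \<open>xi_upper\<close> this is a sign change of an increasing function,
  which pins the root down to five decimals. Writing the argument as 2 * (9 / 5) divided by a ratio
  near 1 reduces its logarithm to the three estimates above.\<close>

lemma xi_lower: "ln (2 * 1.79556) - 1 - 1 / (2 * 1.79556) < (0::real)"
proof -
  have "ln (2 * 1.79556 :: real) = ln (2 * (9 / 5) / (1.8 / 1.79556))" by simp
  also have "\<dots> = ln 2 + ln (9 / 5) - ln (1.8 / 1.79556)"
    by (subst ln_div; subst ln_mult) auto
  finally show ?thesis
    using ln_two_bounds ln_nine_fifths_bounds ln_18_div_bounds(1) by simp
qed

lemma xi_upper: "(0::real) < ln (2 * 1.79557) - 1 - 1 / (2 * 1.79557)"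
proof -
  have "ln (2 * 1.79557 :: real) = ln (2 * (9 / 5) / (1.8 / 1.79557))" by simp
  also have "\<dots> = ln 2 + ln (9 / 5) - ln (1.8 / 1.79557)"
    by (subst ln_div; subst ln_mult) auto
  finally show ?thesis
    using ln_two_bounds ln_nine_fifths_bounds ln_18_div_bounds(2) by simp
qed

lemma is_xi_bounds:
  assumes "is_xi x"
  shows "1.79556 < x \<and> x < 1.79557"
proof -
  have x: "0 < x" and eq: "ln (2 * x) - 1 - 1 / (2 * x) = 0"
    using assms by (auto simp: is_xi_iff)
  show ?thesis
    using xi_fun_strict_mono[of x "1.79556"] xi_fun_strict_mono[of "1.79557" x] x eq xi_lower xi_upper
    by (cases "x = 1.79556"; cases "x = 1.79557") (force simp: not_less)+
qed

lemma ex1_is_xi: "\<exists>!x. is_xi x"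
proof -
  have "\<exists>x\<ge>1.79556. x \<le> 1.79557 \<and> ln (2 * x) - 1 - 1 / (2 * x) = (0::real)"
    using xi_lower xi_upper
    by (intro IVT') (auto intro!: continuous_intros)
  then obtain x where "is_xi x" by (force simp: is_xi_iff)
  moreover have "y = z" if "is_xi y" "is_xi z" for y z
    using that xi_fun_strict_mono[of y z] xi_fun_strict_mono[of z y]
    by (cases y z rule: linorder_cases) (auto simp: is_xi_iff)
  ultimately show ?thesis by blast
qed

lemma is_xi_xi: "is_xi xi"
  unfolding xi_def using ex1_is_xi by (rule theI')

section \<open>Asymptotic comparison of the exponents\<close>

lemma eventually_exp_bound_small:
  fixes A B \<delta> :: real
  assumes "0 < \<delta>"
  shows "\<forall>\<^sub>F n in sequentially. exp (B * real n + A - \<delta> * (real n * ln (real n))) < 1 / 3"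
proof -
  have "filterlim (\<lambda>n :: nat. ln (real n)) at_top sequentially"
    by (rule filterlim_compose[OF ln_at_top filterlim_real_sequentially])
  then have "\<forall>\<^sub>F n in sequentially. (B + 1) / \<delta> \<le> ln (real n)"
    by (simp add: filterlim_at_top)
  moreover have "\<forall>\<^sub>F n in sequentially. A + 3 \<le> real n"
    using filterlim_real_sequentially by (simp add: filterlim_at_top)
  ultimately show ?thesis
  proof eventually_elim
    case (elim n)
    \<comment> \<open>For such \<open>n\<close> the negative term exceeds \<open>B * n\<close> by at
      least \<open>n\<close>, so the exponent is at most \<open>A - n\<close>, hence at most -3. The
      target 1 / 3 lets three such terms add up to less than 1.\<close>
    have "real n * (B + 1) \<le> real n * (\<delta> * ln (real n))"
      using elim(1) assms by (intro mult_left_mono) (auto simp: field_simps)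
    then have "B * real n + A - \<delta> * (real n * ln (real n)) \<le> - 3"
      using elim(2) by (simp add: algebra_simps)
    then have "exp (B * real n + A - \<delta> * (real n * ln (real n))) \<le> exp (- 3)" by simp
    also have "\<dots> = 1 / exp (3 :: real)" by (simp add: exp_minus field_simps)
    also have "\<dots> < 1 / 3"
      using exp_ge_add_one_self[of "3::real"] by (intro divide_strict_left_mono) auto
    finally show ?case .
  qed
qed

lemma power_mult_eq_exp: "0 < x \<Longrightarrow> (x::real) ^ n = exp (real n * ln x)"
  by (simp add: exp_of_nat_mult)

text \<open>The equation of \<open>xi\<close> cleared of its denominator. It says that (2 xi - 1) /
  2 - xi ln (2 xi) = -1: a Chernoff bound with parameter 2 xi at mean (n ln n) / 2 exactly cancels
  the factor n^n for the fine net.\<close>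

lemma xi_mult_ln: "xi * ln (2 * xi) = xi + 1 / 2"
proof -
  have "0 < xi" "ln (2 * xi) = 1 + 1 / (2 * xi)" using is_xi_xi by (auto simp: is_xi_iff)
  then show ?thesis by (simp add: field_simps)
qed

text \<open>The three summands bound, in turn: a fine net point hit too often; a coarse net point
  with fewer than \<open>k n\<close> centres nearby; a fine net point missed although its coarse
  point has enough centres. \<open>q\<close> is the number of centres per ball volume, and the slack
  1 in its lower bound leaves room for rounding the number of centres.\<close>

lemma eventually_union_bound:
  fixes \<epsilon> :: real
  assumes \<epsilon>: "0 < \<epsilon>" "\<epsilon> \<le> 1"
  obtains \<alpha> \<beta> \<gamma> v :: real and k :: "nat \<Rightarrow> real"
  where "0 < \<alpha>" "\<alpha> \<le> 1 / 4" "0 < \<beta>" "\<beta> \<le> 1" "0 < \<gamma>" "4 * \<alpha> + \<gamma> + \<beta>\<^sup>2 \<le> 1" "4 * \<beta>\<^sup>2 \<le> \<gamma>\<^sup>2"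
    "0 < v" "v \<le> 1"
    "\<forall>\<^sub>F n in sequentially. \<forall>q. (1 / 2 + \<epsilon>) * (real n * ln (real n)) - 1 \<le> q \<longrightarrow>
      q \<le> (1 / 2 + \<epsilon>) * (real n * ln (real n)) \<longrightarrow>
      (16 * real n / \<alpha>) ^ n * (exp ((2 * xi - 1) * (q * exp (3 * \<alpha>)))
          / (2 * xi) powr ((xi + 10 * \<epsilon>) * (real n * ln (real n))))
      + (16 * sqrt (real n) / \<beta>) ^ n * (exp (- (1 - v) * (q * (1 - 2 * (4 * \<alpha> + \<gamma> + \<beta>\<^sup>2)))) / v powr k n)
      + (16 * real n / \<alpha>) ^ n * (4 * \<beta>\<^sup>2 / \<gamma>\<^sup>2) powr k n < 1"
proof -
  define \<alpha> where "\<alpha> = \<epsilon> / 100"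
  define \<gamma> where "\<gamma> = \<epsilon> / 100"
  define v where "v = \<epsilon> / 10"
  \<comment> \<open>Makes \<open>v powr (\<rho> * L n)\<close> equal to
    \<open>exp (- (\<epsilon> / 8 * L n))\<close>, half of what the lower tail gains in
    \<open>t2\<close>.\<close>
  define \<rho> where "\<rho> = \<epsilon> / (8 * ln (1 / v))"
  \<comment> \<open>Makes the missed proportion
    \<open>4 * \<beta>\<^sup>2 / \<gamma>\<^sup>2\<close> equal to
    \<open>exp (- (2 / \<rho>))\<close>. Its power \<open>\<rho> * L n\<close> is
    \<open>exp (- (2 * L n))\<close>, which beats the growth \<open>exp (L n)\<close> of the fine
    net.\<close>
  define \<beta> where "\<beta> = \<gamma> / 2 * exp (- (1 / \<rho>))"
  define \<kappa> where "\<kappa> = 4 * \<alpha> + \<gamma> + \<beta>\<^sup>2"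
  have v: "0 < v" "v \<le> 1 / 10" using \<epsilon> by (auto simp: v_def)
  have lnv: "0 < ln (1 / v)" using v by simp
  have \<rho>: "0 < \<rho>" using \<epsilon> lnv by (simp add: \<rho>_def)
  have \<gamma>: "0 < \<gamma>" "\<gamma> \<le> 1 / 100" using \<epsilon> by (auto simp: \<gamma>_def)
  have \<beta>: "0 < \<beta>" "\<beta> \<le> \<gamma> / 2" using \<gamma> \<rho> by (auto simp: \<beta>_def)
  have \<beta>2: "\<beta>\<^sup>2 \<le> (\<gamma> / 2)\<^sup>2" using \<beta> by (intro power_mono) auto
  have \<gamma>2: "(\<gamma> / 2)\<^sup>2 \<le> \<gamma>" using \<gamma> by (simp add: power2_eq_square)
  have \<eta>: "4 * \<beta>\<^sup>2 / \<gamma>\<^sup>2 = exp (- (2 / \<rho>))"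
    using \<gamma> by (simp add: \<beta>_def power_mult_distrib power_divide flip: exp_of_nat_mult)
  have \<kappa>: "\<kappa> \<le> 6 * \<epsilon> / 100" using \<beta>2 \<gamma>2 by (simp add: \<kappa>_def \<alpha>_def \<gamma>_def)
  have x: "1.79556 < xi" "xi < 1.79557" using is_xi_bounds[OF is_xi_xi] by auto
  have lx: "1 < ln (2 * xi)"
  proof -
    have "ln (2 * xi) - 1 = 1 / (2 * xi)" "0 < 1 / (2 * xi)"
      using is_xi_xi by (simp_all add: is_xi_iff)
    then show ?thesis by linarith
  qed
  define L where "L n = real n * ln (real n)" for n :: nat
  have \<epsilon>2: "\<epsilon> * \<epsilon> \<le> \<epsilon>" using \<epsilon> by (simp add: mult_left_le)
  define A1 where "A1 = ln (16 / \<alpha>)"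
  define A2 where "A2 = ln (16 / \<beta>)"
  have e3: "exp (3 * \<alpha>) \<le> 1 + \<epsilon>"
  proof -
    have "exp (3 * \<alpha>) \<le> 1 + 3 * \<alpha> + (3 * \<alpha>)\<^sup>2" using \<epsilon> by (intro exp_bound) (auto simp: \<alpha>_def)
    also have "\<dots> \<le> 1 + \<epsilon>"
    proof -
      have "3 * \<alpha> = 3 / 100 * \<epsilon>" "(3 * \<alpha>)\<^sup>2 = 9 / 10000 * (\<epsilon> * \<epsilon>)"
        by (simp_all add: \<alpha>_def power2_eq_square)
      then show ?thesis using \<epsilon> \<epsilon>2 by linarith
    qed
    finally show ?thesis .
  qed
  have ev1: "\<forall>\<^sub>F n in sequentially. exp (A1 * real n + 0 - \<epsilon> * L n) < 1 / 3"
    unfolding L_def by (rule eventually_exp_bound_small[OF \<epsilon>(1)])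
  have ev2: "\<forall>\<^sub>F n in sequentially. exp (A2 * real n + 1 - (\<epsilon> / 8) * L n) < 1 / 3"
    unfolding L_def using \<epsilon> by (intro eventually_exp_bound_small) simp
  have ev3: "\<forall>\<^sub>F n in sequentially. exp (A1 * real n + 0 - 1 * L n) < 1 / 3"
    unfolding L_def by (intro eventually_exp_bound_small) simp
  have main: "\<forall>\<^sub>F n in sequentially. \<forall>q. (1 / 2 + \<epsilon>) * L n - 1 \<le> q \<longrightarrow> q \<le> (1 / 2 + \<epsilon>) * L n \<longrightarrow>
      (16 * real n / \<alpha>) ^ n * (exp ((2 * xi - 1) * (q * exp (3 * \<alpha>))) / (2 * xi) powr ((xi + 10 * \<epsilon>) * L n))
      + (16 * sqrt (real n) / \<beta>) ^ n * (exp (- (1 - v) * (q * (1 - 2 * \<kappa>))) / v powr (\<rho> * L n))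
      + (16 * real n / \<alpha>) ^ n * (4 * \<beta>\<^sup>2 / \<gamma>\<^sup>2) powr (\<rho> * L n) < 1"
    using ev1 ev2 ev3 eventually_ge_at_top[of 2]
  proof eventually_elim
    case (elim n)
    have n0: "0 < real n" using elim by simp
    have L0: "0 \<le> L n" using elim by (simp add: L_def)
    \<comment> \<open>The fine net contributes \<open>L n\<close> to the exponent; the coarse one,
      in \<open>pow2\<close>, only \<open>L n / 2\<close>, since its spacing is larger by a factor
      of order sqrt n.\<close>
    have pow1: "(16 * real n / \<alpha>) ^ n = exp (A1 * real n + L n)"
    proof -
      have "ln (16 * real n / \<alpha>) = A1 + ln (real n)"
        using \<epsilon> n0 by (simp add: A1_def \<alpha>_def ln_div ln_mult)
      then show ?thesis
        using \<epsilon> n0 by (subst power_mult_eq_exp) (auto simp: \<alpha>_def L_def algebra_simps)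
    qed
    have pow2: "(16 * sqrt (real n) / \<beta>) ^ n = exp (A2 * real n + L n / 2)"
    proof -
      have "ln (16 * sqrt (real n) / \<beta>) = A2 + ln (real n) / 2"
        using \<beta> n0 by (simp add: A2_def ln_div ln_mult ln_sqrt)
      then show ?thesis
        using \<beta> n0 by (subst power_mult_eq_exp) (auto simp: L_def algebra_simps)
    qed
    show ?case
    proof (intro allI impI)
      fix q assume q: "(1 / 2 + \<epsilon>) * L n - 1 \<le> q" "q \<le> (1 / 2 + \<epsilon>) * L n"
      \<comment> \<open>The multiples of \<open>L n\<close> without \<open>\<epsilon>\<close>
        cancel: 1 + (xi - 1/2) - (xi + 1/2) = 0. The errors cost at most
        \<open>7 * \<epsilon>\<close>, and the allowance \<open>10 * \<epsilon>\<close> in the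
        multiplicity covers them.\<close>
      have t1: "exp (A1 * real n + L n) * (exp ((2 * xi - 1) * (q * exp (3 * \<alpha>))) / (2 * xi) powr ((xi + 10 * \<epsilon>) * L n))
        \<le> exp (A1 * real n + 0 - \<epsilon> * L n)"
      proof -
        have "q * exp (3 * \<alpha>) \<le> ((1 / 2 + \<epsilon>) * L n) * (1 + \<epsilon>)"
          using q e3 L0 \<epsilon> by (intro mult_mono) auto
        also have "\<dots> = (1 / 2 + \<epsilon> + \<epsilon> / 2 + \<epsilon> * \<epsilon>) * L n" by (simp add: field_simps)
        also have "\<dots> \<le> (1 / 2 + 5 / 2 * \<epsilon>) * L n"
          using \<epsilon> \<epsilon>2 L0 by (intro mult_right_mono; linarith)
        finally have "(2 * xi - 1) * (q * exp (3 * \<alpha>)) \<le> (2 * xi - 1) * ((1 / 2 + 5 / 2 * \<epsilon>) * L n)"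
          using x by (intro mult_left_mono) auto
        also have "\<dots> = (xi - 1 / 2) * L n + (5 / 2 * (2 * xi - 1)) * (\<epsilon> * L n)" by (simp add: algebra_simps)
        also have "\<dots> \<le> (xi - 1 / 2) * L n + 7 * (\<epsilon> * L n)"
          using x L0 \<epsilon> by (intro add_left_mono mult_right_mono) auto
        finally have 1: "(2 * xi - 1) * (q * exp (3 * \<alpha>)) \<le> (xi - 1 / 2) * L n + 7 * (\<epsilon> * L n)" .
        have "(xi + 10 * \<epsilon>) * L n * ln (2 * xi) = (xi * ln (2 * xi)) * L n + 10 * (\<epsilon> * L n) * ln (2 * xi)"
          by (simp add: algebra_simps)
        also have "\<dots> \<ge> (xi + 1 / 2) * L n + 10 * (\<epsilon> * L n) * 1"
          unfolding xi_mult_ln using lx L0 \<epsilon> by (intro add_left_mono mult_left_mono) auto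
        finally have 2: "(xi + 1 / 2) * L n + 10 * (\<epsilon> * L n) \<le> (xi + 10 * \<epsilon>) * L n * ln (2 * xi)" by simp
        have "A1 * real n + L n + (2 * xi - 1) * (q * exp (3 * \<alpha>)) - (xi + 10 * \<epsilon>) * L n * ln (2 * xi)
          \<le> A1 * real n + 0 - \<epsilon> * L n"
        proof -
          have "c + l + X - Y \<le> c + 0 - e"
            if "X \<le> M - l / 2 + 7 * e" "M + l / 2 + 10 * e \<le> Y" "0 \<le> e" for c l X Y M e :: real
            using that by linarith
          moreover have "(xi - 1 / 2) * L n = xi * L n - L n / 2" "(xi + 1 / 2) * L n = xi * L n + L n / 2"
            by (simp_all add: field_simps)
          moreover have "0 \<le> \<epsilon> * L n" using \<epsilon> L0 by simp
          ultimately show ?thesis using 1 2 by metis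
        qed
        moreover have "(2 * xi) powr ((xi + 10 * \<epsilon>) * L n) = exp ((xi + 10 * \<epsilon>) * L n * ln (2 * xi))"
          using x by (simp add: powr_def)
        ultimately show ?thesis by (simp flip: exp_add exp_diff)
      qed
      \<comment> \<open>The coarse net costs \<open>L n / 2\<close>, while the lower tail yields at
        least \<open>(1 / 2 + \<epsilon> / 4) * L n - 1\<close>. Of the surplus
        \<open>\<epsilon> / 4\<close>, the division by \<open>v powr (\<rho> * L n)\<close> takes
        \<open>\<epsilon> / 8\<close>.\<close>
      have t2: "exp (A2 * real n + L n / 2) * (exp (- (1 - v) * (q * (1 - 2 * \<kappa>))) / v powr (\<rho> * L n))
        \<le> exp (A2 * real n + 1 - (\<epsilon> / 8) * L n)"
      proof -
        let ?b = "(1 - v) * (1 - 2 * \<kappa>)"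
        have b: "1 - \<epsilon> / 4 \<le> ?b" "?b \<le> 1" "0 \<le> ?b"
        proof -
          have \<kappa>0: "0 \<le> \<kappa>" using \<epsilon> by (simp add: \<kappa>_def \<alpha>_def \<gamma>_def)
          have "0 \<le> v * \<kappa>" using v \<kappa>0 by simp
          moreover have "?b = 1 - v - 2 * \<kappa> + 2 * (v * \<kappa>)" by (simp add: algebra_simps)
          ultimately show "1 - \<epsilon> / 4 \<le> ?b" using \<kappa> \<epsilon> v_def by linarith
          then show "0 \<le> ?b" using \<epsilon> by linarith
          show "?b \<le> 1" using v \<kappa>0 \<kappa> \<epsilon> by (intro mult_le_one) auto
        qed
        have "?b * ((1 / 2 + \<epsilon>) * L n) - 1 \<le> ?b * ((1 / 2 + \<epsilon>) * L n - 1)"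
          using b by (simp add: algebra_simps)
        also have "\<dots> \<le> ?b * q" using q b by (intro mult_left_mono) auto
        finally have 1: "?b * ((1 / 2 + \<epsilon>) * L n) - 1 \<le> ?b * q" .
        have "(1 - \<epsilon> / 4) * ((1 / 2 + \<epsilon>) * L n) \<le> ?b * ((1 / 2 + \<epsilon>) * L n)"
          using b L0 \<epsilon> by (intro mult_right_mono) auto
        moreover have "(1 / 2 + \<epsilon> / 4) * L n \<le> (1 - \<epsilon> / 4) * (1 / 2 + \<epsilon>) * L n"
        proof (intro mult_right_mono L0)
          have "(1 - \<epsilon> / 4) * (1 / 2 + \<epsilon>) = 1 / 2 + 7 / 8 * \<epsilon> - (\<epsilon> * \<epsilon>) / 4"
            by (simp add: algebra_simps)
          then show "1 / 2 + \<epsilon> / 4 \<le> (1 - \<epsilon> / 4) * (1 / 2 + \<epsilon>)" using \<epsilon> \<epsilon>2 by linarith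
        qed
        ultimately have 2: "(1 / 2 + \<epsilon> / 4) * L n - 1 \<le> ?b * q" using 1 by (simp add: mult.assoc)
        have "v powr (\<rho> * L n) = exp (- (\<epsilon> / 8 * L n))"
        proof -
          have "\<rho> * L n * ln v = - (\<epsilon> / 8 * L n)"
            using lnv v by (simp add: \<rho>_def ln_div field_simps)
          then show ?thesis using v by (simp add: powr_def)
        qed
        moreover have "- (1 - v) * (q * (1 - 2 * \<kappa>)) = - (?b * q)" by (simp add: algebra_simps)
        ultimately show ?thesis using 2 by (simp add: algebra_simps flip: exp_add exp_diff)
      qed
      have t3: "exp (A1 * real n + L n) * (4 * \<beta>\<^sup>2 / \<gamma>\<^sup>2) powr (\<rho> * L n) = exp (A1 * real n + 0 - 1 * L n)"
      proof -
        have "\<rho> * L n * (2 / \<rho>) = 2 * L n" using \<rho> by simp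
        then have "(4 * \<beta>\<^sup>2 / \<gamma>\<^sup>2) powr (\<rho> * L n) = exp (- (2 * L n))"
          unfolding \<eta> by (simp add: powr_def)
        then show ?thesis by (simp flip: exp_add)
      qed
      show "(16 * real n / \<alpha>) ^ n * (exp ((2 * xi - 1) * (q * exp (3 * \<alpha>))) / (2 * xi) powr ((xi + 10 * \<epsilon>) * L n))
        + (16 * sqrt (real n) / \<beta>) ^ n * (exp (- (1 - v) * (q * (1 - 2 * \<kappa>))) / v powr (\<rho> * L n))
        + (16 * real n / \<alpha>) ^ n * (4 * \<beta>\<^sup>2 / \<gamma>\<^sup>2) powr (\<rho> * L n) < 1"
        unfolding pow1 pow2 t3 using t1 t2 elim(1-3) by linarith
    qed
  qed
  show ?thesis
  proof (rule that[of \<alpha> \<beta> \<gamma> v "\<lambda>n. \<rho> * L n"])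
    show "4 * \<alpha> + \<gamma> + \<beta>\<^sup>2 \<le> 1" using \<kappa> \<epsilon> by (simp add: \<kappa>_def)
    show "4 * \<beta>\<^sup>2 \<le> \<gamma>\<^sup>2" using \<beta>2 by (simp add: power_divide)
  qed (use \<epsilon> v \<beta> \<gamma> main in \<open>auto simp: \<alpha>_def L_def \<kappa>_def\<close>)
qed

section \<open>Random choices in a finite set\<close>

lemma sum_prod_PiE_lessThan:
  fixes h :: "'c \<Rightarrow> real"
  assumes "finite G"
  shows "(\<Sum>f\<in>PiE {..<N} (\<lambda>_. G). \<Prod>i<N. h (f i)) = (\<Sum>c\<in>G. h c) ^ N"
  using prod_sum_PiE[of "{..<N}" "\<lambda>_. G" "\<lambda>_. h"] assms by simp

text \<open>Markov's inequality for a product of independent weights, phrased by counting: summed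
  over all choices, the product factors into a power. The three bounds on bad choices below differ
  only in the weight \<open>h\<close>.\<close>

lemma card_markov_le:
  fixes h :: "'c \<Rightarrow> real"
  assumes G: "finite G" and h: "\<And>c. c \<in> G \<Longrightarrow> 0 \<le> h c" and M: "0 < M"
    and bad: "\<And>f. f \<in> PiE {..<N} (\<lambda>_. G) \<Longrightarrow> Q f \<Longrightarrow> M \<le> (\<Prod>i<N. h (f i))"
  shows "real (card {f \<in> PiE {..<N} (\<lambda>_. G). Q f}) \<le> (\<Sum>c\<in>G. h c) ^ N / M"
proof -
  let ?F = "PiE {..<N} (\<lambda>_. G)"
  have fin: "finite ?F" using G by (intro finite_PiE) auto
  have "real (card {f \<in> ?F. Q f}) * M = (\<Sum>f\<in>{f \<in> ?F. Q f}. M)" by simp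
  also have "\<dots> \<le> (\<Sum>f\<in>{f \<in> ?F. Q f}. \<Prod>i<N. h (f i))"
    using bad by (intro sum_mono) auto
  also have "\<dots> \<le> (\<Sum>f\<in>?F. \<Prod>i<N. h (f i))"
    using h by (intro sum_mono2 fin) (auto intro!: prod_nonneg)
  also have "\<dots> = (\<Sum>c\<in>G. h c) ^ N" using G by (rule sum_prod_PiE_lessThan)
  finally show ?thesis using M by (simp add: field_simps)
qed

lemma prod_if_eq_power_card:
  fixes z :: real
  assumes "finite I"
  shows "(\<Prod>i\<in>I. if Q i then z else 1) = z ^ card {i \<in> I. Q i}"
  using assms by (simp add: prod.If_cases Int_def)

lemma sum_if_mem:
  fixes z :: real
  assumes "finite G" "D \<subseteq> G"
  shows "(\<Sum>c\<in>G. if c \<in> D then z else 1) = real (card G) + (z - 1) * real (card D)"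
proof -
  have "(\<Sum>c\<in>G. if c \<in> D then z else 1) = (\<Sum>c\<in>G. 1 + (if c \<in> D then z - 1 else 0))"
    by (intro sum.cong) auto
  also have "\<dots> = real (card G) + (\<Sum>c\<in>G. if c \<in> D then z - 1 else 0)"
    by (simp add: sum.distrib)
  also have "(\<Sum>c\<in>G. if c \<in> D then z - 1 else 0) = (\<Sum>c\<in>G \<inter> D. z - 1)"
    by (rule sum.inter_restrict[symmetric]) (use assms in auto)
  also have "G \<inter> D = D" using assms by auto
  finally show ?thesis by simp
qed

lemma power_le_exp_mult:
  fixes g d :: real
  assumes "0 < g" "0 \<le> g + d"
  shows "(g + d) ^ N \<le> g ^ N * exp (real N * d / g)"
proof -
  have "(g + d) ^ N = g ^ N * (1 + d / g) ^ N"
    using assms by (simp flip: power_mult_distrib add: field_simps)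
  also have "(1 + d / g) ^ N \<le> exp (d / g) ^ N"
    using assms by (intro power_mono exp_ge_add_one_self) (auto simp: field_simps)
  also have "exp (d / g) ^ N = exp (real N * d / g)"
    by (simp flip: exp_of_nat_mult)
  finally show ?thesis using assms by simp
qed

text \<open>Upper Chernoff bound: weight \<open>z\<close> on \<open>D\<close> puts the number of
  hits into an exponent. As \<open>z\<close> is at least 1, the total weight grows with
  \<open>D\<close>, so an upper bound on its size is enough.\<close>

lemma card_many_hits_le:
  fixes z m d :: real
  assumes G: "finite G" "G \<noteq> {}" and D: "D \<subseteq> G" "real (card D) \<le> d" and z: "1 \<le> z"
  shows "real (card {f \<in> PiE {..<N} (\<lambda>_. G). m < real (card {i \<in> {..<N}. f i \<in> D})})
    \<le> real (card G) ^ N * (exp ((z - 1) * real N * d / real (card G)) / z powr m)"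
proof -
  let ?h = "\<lambda>c. if c \<in> D then z else 1"
  have g: "0 < real (card G)" using G by (simp add: card_gt_0_iff)
  have "real (card {f \<in> PiE {..<N} (\<lambda>_. G). m < real (card {i \<in> {..<N}. f i \<in> D})})
      \<le> (\<Sum>c\<in>G. ?h c) ^ N / z powr m"
  proof (rule card_markov_le)
    fix f assume "m < real (card {i \<in> {..<N}. f i \<in> D})"
    then have "z powr m \<le> z powr real (card {i \<in> {..<N}. f i \<in> D})"
      using z by (intro powr_mono) auto
    then show "z powr m \<le> (\<Prod>i<N. ?h (f i))"
      using z by (simp add: prod_if_eq_power_card powr_realpow)
  qed (use G z in auto)
  also have "(\<Sum>c\<in>G. ?h c) ^ N = (real (card G) + (z - 1) * real (card D)) ^ N"
    using G D by (simp add: sum_if_mem)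
  also have "\<dots> \<le> (real (card G) + (z - 1) * d) ^ N"
    using z D by (intro power_mono add_left_mono mult_left_mono) auto
  also have "\<dots> \<le> real (card G) ^ N * exp (real N * ((z - 1) * d) / real (card G))"
    using g z D by (intro power_le_exp_mult) (auto intro!: add_nonneg_nonneg mult_nonneg_nonneg)
  finally show ?thesis using z by (simp add: divide_right_mono mult_ac)
qed

text \<open>Lower Chernoff bound: a weight \<open>w\<close> of at most 1 on \<open>E\<close> makes
  the product large when there are few hits.\<close>

lemma card_few_hits_le:
  fixes w k e :: real
  assumes G: "finite G" "G \<noteq> {}" and E: "E \<subseteq> G" "e \<le> real (card E)" and w: "0 < w" "w \<le> 1"
  shows "real (card {f \<in> PiE {..<N} (\<lambda>_. G). real (card {i \<in> {..<N}. f i \<in> E}) < k})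
    \<le> real (card G) ^ N * (exp (- (1 - w) * real N * e / real (card G)) / w powr k)"
proof -
  let ?h = "\<lambda>c. if c \<in> E then w else 1"
  have g: "0 < real (card G)" using G by (simp add: card_gt_0_iff)
  have 1: "real (card {f \<in> PiE {..<N} (\<lambda>_. G). real (card {i \<in> {..<N}. f i \<in> E}) < k})
      \<le> (\<Sum>c\<in>G. ?h c) ^ N / w powr k"
  proof (rule card_markov_le)
    fix f assume "real (card {i \<in> {..<N}. f i \<in> E}) < k"
    then have "w powr k \<le> w powr real (card {i \<in> {..<N}. f i \<in> E})"
      using w by (intro powr_mono') auto
    then show "w powr k \<le> (\<Prod>i<N. ?h (f i))"
      using w by (simp add: prod_if_eq_power_card powr_realpow)
  qed (use G w in auto)
  have "(\<Sum>c\<in>G. ?h c) ^ N = (real (card G) + (w - 1) * real (card E)) ^ N"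
    using G E by (simp add: sum_if_mem)
  also have "\<dots> \<le> real (card G) ^ N * exp (real N * ((w - 1) * real (card E)) / real (card G))"
  proof (intro power_le_exp_mult g)
    have "(1 - w) * real (card E) \<le> 1 * real (card G)"
      using w E G by (intro mult_mono) (auto intro: card_mono)
    then show "0 \<le> real (card G) + (w - 1) * real (card E)" by (simp add: algebra_simps)
  qed
  also have "\<dots> \<le> real (card G) ^ N * exp (- (1 - w) * real N * e / real (card G))"
  proof -
    have "(1 - w) * real N * e \<le> (1 - w) * real N * real (card E)"
      using w E by (intro mult_left_mono) auto
    then have "real N * ((w - 1) * real (card E)) / real (card G) \<le> - (1 - w) * real N * e / real (card G)"
      using g by (intro divide_right_mono) (auto simp: algebra_simps)
    then show ?thesis by (intro mult_left_mono) auto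
  qed
  finally have "(\<Sum>c\<in>G. ?h c) ^ N / w powr k
      \<le> real (card G) ^ N * exp (- (1 - w) * real N * e / real (card G)) / w powr k"
    by (rule divide_right_mono) simp
  with 1 show ?thesis by simp
qed

text \<open>Weight \<open>0\<close> on \<open>C\<close> and \<open>1 / \<eta>\<close> on \<open>E - C\<close> gives total weight at most \<open>card G\<close>.\<close>

lemma card_hits_but_not_le:
  fixes \<eta> k :: real
  assumes G: "finite G" "G \<noteq> {}" and E: "E \<subseteq> G" and \<eta>: "0 < \<eta>" "\<eta> \<le> 1"
    and small: "real (card (E - C)) \<le> \<eta> * real (card E)"
  shows "real (card {f \<in> PiE {..<N} (\<lambda>_. G).
      k \<le> real (card {i \<in> {..<N}. f i \<in> E}) \<and> (\<forall>i<N. f i \<notin> C)})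
    \<le> real (card G) ^ N * \<eta> powr k"
proof -
  let ?h = "\<lambda>c. if c \<in> C then 0 else if c \<in> E then 1 / \<eta> else 1"
  have "real (card {f \<in> PiE {..<N} (\<lambda>_. G).
      k \<le> real (card {i \<in> {..<N}. f i \<in> E}) \<and> (\<forall>i<N. f i \<notin> C)})
      \<le> (\<Sum>c\<in>G. ?h c) ^ N / (1 / \<eta>) powr k"
  proof (rule card_markov_le)
    fix f assume f: "k \<le> real (card {i \<in> {..<N}. f i \<in> E}) \<and> (\<forall>i<N. f i \<notin> C)"
    then have "(1 / \<eta>) powr k \<le> (1 / \<eta>) powr real (card {i \<in> {..<N}. f i \<in> E})"
      using \<eta> by (intro powr_mono) auto
    also have "\<dots> = (\<Prod>i<N. if f i \<in> E then 1 / \<eta> else 1)"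
      using \<eta> by (simp add: prod_if_eq_power_card powr_realpow)
    \<comment> \<open>No choice lies in \<open>C\<close>, so the weight 0 never enters the
      product.\<close>
    also have "\<dots> = (\<Prod>i<N. ?h (f i))" using f by (intro prod.cong) auto
    finally show "(1 / \<eta>) powr k \<le> (\<Prod>i<N. ?h (f i))" .
  qed (use G \<eta> in auto)
  also have "(\<Sum>c\<in>G. ?h c) \<le> real (card G)"
  proof -
    \<comment> \<open>Equality holds pointwise except on \<open>C - E\<close>, where 0 is raised to
      1. Subtracting the indicator of \<open>E\<close> is what pays for the weight
      \<open>1 / \<eta>\<close> on \<open>E - C\<close>.\<close>
    have "(\<Sum>c\<in>G. ?h c) \<le> (\<Sum>c\<in>G. 1 + ((if c \<in> E - C then 1 / \<eta> else 0) - (if c \<in> E then 1 else 0)))"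
      by (intro sum_mono) auto
    also have "\<dots> = real (card G) + (\<Sum>c\<in>G. if c \<in> E - C then 1 / \<eta> else 0)
        - (\<Sum>c\<in>G. if c \<in> E then 1 else 0)"
      by (simp only: sum.distrib sum_subtractf) simp
    also have "(\<Sum>c\<in>G. if c \<in> E - C then 1 / \<eta> else 0) = (\<Sum>c\<in>G \<inter> (E - C). 1 / \<eta>)"
      by (rule sum.inter_restrict[symmetric]) (use G in auto)
    also have "\<dots> = real (card (E - C)) / \<eta>"
    proof -
    have "G \<inter> (E - C) = E - C" using E by auto
    then show ?thesis by simp
  qed
    also have "(\<Sum>c\<in>G. if c \<in> E then 1 else (0::real)) = (\<Sum>c\<in>G \<inter> E. 1)"
      by (rule sum.inter_restrict[symmetric]) (use G in auto)
    also have "\<dots> = real (card E)" using E by (simp add: Int_absorb1)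
    finally have "(\<Sum>c\<in>G. ?h c) \<le> real (card G) + real (card (E - C)) / \<eta> - real (card E)" .
    moreover have "real (card (E - C)) / \<eta> \<le> real (card E)"
      using small \<eta> by (simp add: field_simps)
    ultimately show ?thesis by linarith
  qed
  then have "(\<Sum>c\<in>G. ?h c) ^ N \<le> real (card G) ^ N"
    using \<eta> by (intro power_mono sum_nonneg) auto
  finally show ?thesis using \<eta> by (simp add: divide_right_mono powr_divide powr_one_eq_one)
qed

text \<open>Union bound over the events \<open>A1\<close>, \<open>A2\<close> and \<open>A3\<close>.
  The lower tail is demanded only at the points of \<open>T\<close>, and \<open>\<tau>\<close>
  passes it on to the points of \<open>U\<close>. In the application \<open>T\<close> is much the
  smaller net, so the weak lower tail is multiplied only by its size.\<close>

lemma random_choice_exists: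
  fixes z w \<eta> m k d e :: real and C D :: "'u \<Rightarrow> 'c set" and E :: "'t \<Rightarrow> 'c set"
  assumes G: "finite G" "G \<noteq> {}" and fin: "finite U" "finite T"
    and D: "\<And>u. u \<in> U \<Longrightarrow> D u \<subseteq> G \<and> real (card (D u)) \<le> d"
    and E: "\<And>t. t \<in> T \<Longrightarrow> E t \<subseteq> G \<and> e \<le> real (card (E t))"
    and near: "\<And>u. u \<in> U \<Longrightarrow> \<tau> u \<in> T \<and> real (card (E (\<tau> u) - C u)) \<le> \<eta> * real (card (E (\<tau> u)))"
    and par: "1 \<le> z" "0 < w" "w \<le> 1" "0 < \<eta>" "\<eta> \<le> 1"
    and less: "real (card U) * (exp ((z - 1) * real N * d / real (card G)) / z powr m)
      + real (card T) * (exp (- (1 - w) * real N * e / real (card G)) / w powr k)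
      + real (card U) * \<eta> powr k < 1"
  shows "\<exists>f\<in>PiE {..<N} (\<lambda>_. G). \<forall>u\<in>U.
      real (card {i \<in> {..<N}. f i \<in> D u}) \<le> m \<and> (\<exists>i<N. f i \<in> C u)"
proof (rule ccontr)
  let ?F = "PiE {..<N} (\<lambda>_. G)"
  define A1 where "A1 u = {f \<in> ?F. m < real (card {i \<in> {..<N}. f i \<in> D u})}" for u
  define A2 where "A2 t = {f \<in> ?F. real (card {i \<in> {..<N}. f i \<in> E t}) < k}" for t
  define A3 where "A3 u = {f \<in> ?F. k \<le> real (card {i \<in> {..<N}. f i \<in> E (\<tau> u)}) \<and> (\<forall>i<N. f i \<notin> C u)}" for u
  assume neg: "\<not> ?thesis"
  have finF: "finite ?F" using G by (intro finite_PiE) auto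
  have "?F \<subseteq> (\<Union>u\<in>U. A1 u) \<union> (\<Union>t\<in>T. A2 t) \<union> (\<Union>u\<in>U. A3 u)"
  proof
    fix f assume f: "f \<in> ?F"
    with neg obtain u where u: "u \<in> U"
      and *: "\<not> (real (card {i \<in> {..<N}. f i \<in> D u}) \<le> m \<and> (\<exists>i<N. f i \<in> C u))" by blast
    \<comment> \<open>If \<open>C u\<close> is missed, then \<open>E (\<tau> u)\<close> received
      either fewer than \<open>k\<close> choices or at least \<open>k\<close>, with none of the
      choices in \<open>C u\<close>.\<close>
    have "f \<in> A1 u \<or> f \<in> A2 (\<tau> u) \<or> f \<in> A3 u"
    proof (cases "\<exists>i<N. f i \<in> C u")
      case True
      with * f show ?thesis by (simp add: A1_def not_le)
    next
      case False
      with f show ?thesis by (auto simp: A2_def A3_def not_le)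
    qed
    then show "f \<in> (\<Union>u\<in>U. A1 u) \<union> (\<Union>t\<in>T. A2 t) \<union> (\<Union>u\<in>U. A3 u)"
      using u near by blast
  qed
  then have "card ?F \<le> card ((\<Union>u\<in>U. A1 u) \<union> (\<Union>t\<in>T. A2 t) \<union> (\<Union>u\<in>U. A3 u))"
    by (rule card_mono[rotated]) (use finF fin in \<open>auto simp: A1_def A2_def A3_def\<close>)
  also have "\<dots> \<le> card (\<Union>u\<in>U. A1 u) + card (\<Union>t\<in>T. A2 t) + card (\<Union>u\<in>U. A3 u)"
    by (intro order_trans[OF card_Un_le] add_mono card_Un_le order_refl)
  also have "\<dots> \<le> (\<Sum>u\<in>U. card (A1 u)) + (\<Sum>t\<in>T. card (A2 t)) + (\<Sum>u\<in>U. card (A3 u))"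
    by (intro add_mono card_UN_le fin)
  finally have "real (card ?F) \<le> real ((\<Sum>u\<in>U. card (A1 u)) + (\<Sum>t\<in>T. card (A2 t)) + (\<Sum>u\<in>U. card (A3 u)))"
    by (rule of_nat_mono)
  also have "\<dots> = (\<Sum>u\<in>U. real (card (A1 u))) + (\<Sum>t\<in>T. real (card (A2 t))) + (\<Sum>u\<in>U. real (card (A3 u)))"
    by simp
  also have "\<dots> \<le> (\<Sum>u\<in>U. real (card G) ^ N * (exp ((z - 1) * real N * d / real (card G)) / z powr m))
      + (\<Sum>t\<in>T. real (card G) ^ N * (exp (- (1 - w) * real N * e / real (card G)) / w powr k))
      + (\<Sum>u\<in>U. real (card G) ^ N * \<eta> powr k)"
  proof (intro add_mono sum_mono)
    show "real (card (A1 u)) \<le> real (card G) ^ N * (exp ((z - 1) * real N * d / real (card G)) / z powr m)"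
      if "u \<in> U" for u
      unfolding A1_def using G D[OF that] par by (intro card_many_hits_le) blast+
    show "real (card (A2 t)) \<le> real (card G) ^ N * (exp (- (1 - w) * real N * e / real (card G)) / w powr k)"
      if "t \<in> T" for t
      unfolding A2_def using G E[OF that] par by (intro card_few_hits_le) blast+
    show "real (card (A3 u)) \<le> real (card G) ^ N * \<eta> powr k" if "u \<in> U" for u
      unfolding A3_def using G E[of "\<tau> u"] near[OF that] par by (intro card_hits_but_not_le) blast+
  qed
  also have "\<dots> = real (card G) ^ N * (real (card U) * (exp ((z - 1) * real N * d / real (card G)) / z powr m)
      + real (card T) * (exp (- (1 - w) * real N * e / real (card G)) / w powr k)
      + real (card U) * \<eta> powr k)"
    by (simp add: algebra_simps)
  also have "\<dots> < real (card G) ^ N * 1"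
    using less G by (intro mult_strict_left_mono) (auto simp: card_gt_0_iff)
  also have "real (card G) ^ N = real (card ?F)" by (simp add: card_PiE)
  finally show False by simp
qed

section \<open>Integer points in balls\<close>

abbreviation zspace :: "nat \<Rightarrow> (nat \<Rightarrow> int) set" where
  "zspace n \<equiv> PiE {..<n} (\<lambda>_. UNIV)"

abbreviation emb :: "(nat \<Rightarrow> int) \<Rightarrow> nat \<Rightarrow> real" where
  "emb v \<equiv> (\<lambda>i. real_of_int (v i))"

definition zball :: "nat \<Rightarrow> (nat \<Rightarrow> real) \<Rightarrow> real \<Rightarrow> (nat \<Rightarrow> int) set" where
  "zball n x r = {v \<in> zspace n. edist n (emb v) x \<le> r}"

text \<open>The sum is restricted so that it stays extensional. The shift \<open>h\<close> itself
  may be any function, so that negatives and differences of points serve as shifts directly.\<close>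

definition zshift :: "nat \<Rightarrow> (nat \<Rightarrow> int) \<Rightarrow> (nat \<Rightarrow> int) \<Rightarrow> nat \<Rightarrow> int" where
  "zshift n h v = (\<lambda>i\<in>{..<n}. v i + h i)"

lemma edist_commute: "edist n x y = edist n y x"
  by (simp add: edist_def L2_set_def power2_commute)

lemma edist_triangle: "edist n x z \<le> edist n x y + edist n y z"
  using L2_set_triangle_ineq[of "\<lambda>i. x i - y i" "\<lambda>i. y i - z i" "{..<n}"]
  by (simp add: edist_def)

lemma edist_cong: "(\<And>i. i < n \<Longrightarrow> x i - y i = x' i - y' i) \<Longrightarrow> edist n x y = edist n x' y'"
  by (simp add: edist_def L2_set_def)

lemma edist_self [simp]: "edist n x x = 0"
  by (simp add: edist_def L2_set_def)

lemma edist_nonneg [simp]: "0 \<le> edist n x y"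
  by (simp add: edist_def)

lemma edist_power2: "(edist n x y)\<^sup>2 = (\<Sum>i<n. (x i - y i)\<^sup>2)"
  by (simp add: edist_def L2_set_def sum_nonneg)

lemma abs_diff_le_edist: "i < n \<Longrightarrow> \<bar>x i - y i\<bar> \<le> edist n x y"
  using member_le_L2_set[of "{..<n}" i "\<lambda>i. \<bar>x i - y i\<bar>"] by (simp add: edist_def L2_set_def)

lemma edist_le_sqrt:
  assumes "\<And>i. i < n \<Longrightarrow> \<bar>x i - y i\<bar> \<le> 1"
  shows "edist n x y \<le> sqrt (real n)"
proof -
  have "edist n x y = L2_set (\<lambda>i. \<bar>x i - y i\<bar>) {..<n}" by (simp add: edist_def L2_set_def)
  also have "\<dots> \<le> L2_set (\<lambda>_. 1) {..<n}" using assms by (intro L2_set_mono) auto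
  finally show ?thesis by (simp add: L2_set_constant)
qed

lemma zshift_in [simp]: "zshift n h v \<in> zspace n"
  by (simp add: zshift_def)

lemma zshift_apply [simp]: "i < n \<Longrightarrow> zshift n h v i = v i + h i"
  by (simp add: zshift_def)

lemma zshift_uminus: "v \<in> zspace n \<Longrightarrow> zshift n (\<lambda>i. - h i) (zshift n h v) = v"
  by (rule PiE_ext[where k = "{..<n}"]) auto

lemma zshift_uminus': "v \<in> zspace n \<Longrightarrow> zshift n h (zshift n (\<lambda>i. - h i) v) = v"
  by (rule PiE_ext[where k = "{..<n}"]) auto

lemma inj_on_zshift: "inj_on (zshift n h) (zspace n)"
  by (rule inj_on_inverseI[where g = "zshift n (\<lambda>i. - h i)"]) (rule zshift_uminus)

lemma edist_zshift: "edist n (emb (zshift n h v)) (\<lambda>i. x i + real_of_int (h i)) = edist n (emb v) x"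
  by (rule edist_cong) simp

lemma zball_subset: "zball n x r \<subseteq> zspace n"
  by (auto simp: zball_def)

lemma zball_cong: "(\<And>i. i < n \<Longrightarrow> x i = y i) \<Longrightarrow> zball n x r = zball n y r"
proof -
  assume "\<And>i. i < n \<Longrightarrow> x i = y i"
  then have "edist n z x = edist n z y" for z by (intro edist_cong) simp
  then show ?thesis by (simp add: zball_def)
qed

lemma zball_subset_zball: "edist n x y + r \<le> s \<Longrightarrow> zball n x r \<subseteq> zball n y s"
proof
  fix v assume "edist n x y + r \<le> s" "v \<in> zball n x r"
  then show "v \<in> zball n y s" using edist_triangle[of n "emb v" y x] by (auto simp: zball_def)
qed

lemma zshift_image_zball: "zshift n h ` zball n x r = zball n (\<lambda>i. x i + real_of_int (h i)) r"
proof
  show "zshift n h ` zball n x r \<subseteq> zball n (\<lambda>i. x i + real_of_int (h i)) r"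
  proof
    fix v assume "v \<in> zshift n h ` zball n x r"
    then obtain u where "u \<in> zball n x r" "v = zshift n h u" by blast
    then show "v \<in> zball n (\<lambda>i. x i + real_of_int (h i)) r"
      using edist_zshift[of n h u x] by (simp only: zball_def mem_Collect_eq zshift_in)
  qed
  show "zball n (\<lambda>i. x i + real_of_int (h i)) r \<subseteq> zshift n h ` zball n x r"
  proof
    fix v assume v: "v \<in> zball n (\<lambda>i. x i + real_of_int (h i)) r"
    then have vz: "v \<in> zspace n" using zball_subset by blast
    have "edist n (emb (zshift n (\<lambda>i. - h i) v)) x = edist n (emb v) (\<lambda>i. x i + real_of_int (h i))"
      by (rule edist_cong) simp
    with v have "zshift n (\<lambda>i. - h i) v \<in> zball n x r" by (simp only: zball_def mem_Collect_eq zshift_in)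
    then show "v \<in> zshift n h ` zball n x r"
      by (rule image_eqI[where x = "zshift n (\<lambda>i. - h i) v", rotated]) (simp only: zshift_uminus'[OF vz])
  qed
qed

lemma card_zball_shift: "card (zball n (\<lambda>i. x i + real_of_int (h i)) r) = card (zball n x r)"
  using card_image[OF inj_on_subset[OF inj_on_zshift zball_subset], of n h x r]
  by (simp add: zshift_image_zball)

lemma card_zball_emb: "card (zball n (emb u) r) = card (zball n (\<lambda>_. 0) r)"
  using card_zball_shift[of n "\<lambda>_. 0" u r] by simp

lemma finite_zball: "finite (zball n x r)"
proof (rule finite_subset)
  show "zball n x r \<subseteq> PiE {..<n} (\<lambda>i. {\<lfloor>x i - r\<rfloor>..\<lceil>x i + r\<rceil>})"
  proof
    fix v assume v: "v \<in> zball n x r"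
    have "\<bar>real_of_int (v i) - x i\<bar> \<le> r" if "i < n" for i
      using abs_diff_le_edist[OF that, of "emb v" x] v by (simp add: zball_def)
    then have "x i - r \<le> real_of_int (v i) \<and> real_of_int (v i) \<le> x i + r" if "i < n" for i
      using that by (auto simp: abs_le_iff algebra_simps)
    then have "\<lfloor>x i - r\<rfloor> \<le> v i \<and> v i \<le> \<lceil>x i + r\<rceil>" if "i < n" for i
      using that by (fastforce simp: floor_le_iff le_ceiling_iff)
    then show "v \<in> PiE {..<n} (\<lambda>i. {\<lfloor>x i - r\<rfloor>..\<lceil>x i + r\<rceil>})"
      using v by (auto simp: zball_def PiE_iff)
  qed
qed (intro finite_PiE; simp)

section \<open>Volumes of balls and counts of integer points\<close>

lemma space_PiM_lborel: "space (PiM {..<n} (\<lambda>_. lborel :: real measure)) = rspace n"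
  by (simp add: space_PiM)

lemma eball_in_sets [measurable]: "eball n r x \<in> sets (PiM {..<n} (\<lambda>_. lborel))"
proof -
  have "(\<lambda>y. edist n x y) \<in> borel_measurable (PiM {..<n} (\<lambda>_. lborel))"
    unfolding edist_def L2_set_def by measurable
  then have "{y \<in> space (PiM {..<n} (\<lambda>_. lborel)). edist n x y \<le> r} \<in> sets (PiM {..<n} (\<lambda>_. lborel))"
    by measurable
  then show ?thesis by (simp add: eball_def space_PiM_lborel)
qed

lemma product_sigma_finite_lborel: "product_sigma_finite (\<lambda>_. lborel :: real measure)"
  by (intro product_sigma_finite.intro sigma_finite_lborel)

text \<open>The product measure is determined by its values on boxes, so translation invariance
  reduces to that of Lebesgue measure in each coordinate.\<close>

lemma distr_translate_PiM_lborel: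
  fixes n :: nat and t :: "nat \<Rightarrow> real"
  shows "distr (PiM {..<n} (\<lambda>_. lborel)) (PiM {..<n} (\<lambda>_. lborel)) (\<lambda>y. \<lambda>i\<in>{..<n}. y i + t i)
    = PiM {..<n} (\<lambda>_. lborel :: real measure)" (is "distr ?M ?M ?f = _")
proof (rule product_sigma_finite.PiM_eqI[where M = "\<lambda>_. lborel" and I = "{..<n}"])
  show "product_sigma_finite (\<lambda>_ :: nat. lborel :: real measure)"
    by (rule product_sigma_finite_lborel)
  show "finite {..<n}" "sets (distr ?M ?M ?f) = sets ?M" by simp_all
  have f [measurable]: "?f \<in> measurable ?M ?M" by (rule measurable_restrict) measurable
  fix A :: "nat \<Rightarrow> real set" assume A: "\<And>i. i \<in> {..<n} \<Longrightarrow> A i \<in> sets lborel"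
  have eq: "?f -` PiE {..<n} A \<inter> space ?M = PiE {..<n} (\<lambda>i. (\<lambda>y. y + t i) -` A i)"
    by (auto simp: space_PiM PiE_iff)
  have meas: "(\<lambda>y. y + t i) -` A i \<in> sets lborel" if "i < n" for i
  proof -
    have "(\<lambda>y. y + t i) \<in> borel_measurable borel" by measurable
    from measurable_sets[OF this, of "A i"] A that show ?thesis by simp
  qed
  have "emeasure (distr ?M ?M ?f) (PiE {..<n} A) = emeasure ?M (PiE {..<n} (\<lambda>i. (\<lambda>y. y + t i) -` A i))"
    using A by (subst emeasure_distr) (auto simp: eq)
  also have "\<dots> = (\<Prod>i<n. emeasure lborel ((\<lambda>y. y + t i) -` A i))"
    using meas by (intro product_sigma_finite.emeasure_PiM[OF product_sigma_finite_lborel]) simp_all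
  also have "\<dots> = (\<Prod>i<n. emeasure lborel (A i))"
  proof (intro prod.cong refl)
    fix i assume "i \<in> {..<n}"
    then have "emeasure lborel (A i) = emeasure (distr lborel borel ((+) (t i))) (A i)"
      by (simp add: lborel_distr_plus)
    also have "\<dots> = emeasure lborel ((+) (t i) -` A i)"
      using A \<open>i \<in> {..<n}\<close> by (subst emeasure_distr) auto
    finally show "emeasure lborel ((\<lambda>y. y + t i) -` A i) = emeasure lborel (A i)"
      by (simp add: vimage_def add.commute)
  qed
  finally show "emeasure (distr ?M ?M ?f) (PiE {..<n} A) = (\<Prod>i<n. emeasure lborel (A i))" .
qed

lemma vol_eball_zero:
  assumes "0 < r"
  shows "vol n (eball n r (\<lambda>_. 0)) = ennreal (unit_ball_vol (real n) * r ^ n)"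
proof -
  have "eball n r (\<lambda>_. 0) = {f. sqrt (\<Sum>i<n. (f i)\<^sup>2) \<le> r} \<inter> space (PiM {..<n} (\<lambda>_. lborel :: real measure))"
    by (auto simp: eball_def edist_def L2_set_def space_PiM)
  then show ?thesis using emeasure_cball_aux[of "{..<n}" r] assms by (simp add: vol_def)
qed

lemma vol_eball:
  assumes "0 < r"
  shows "vol n (eball n r x) = ennreal (unit_ball_vol (real n) * r ^ n)"
proof -
  let ?M = "PiM {..<n} (\<lambda>_. lborel :: real measure)"
  let ?f = "\<lambda>y. \<lambda>i\<in>{..<n}. y i + x i"
  have f [measurable]: "?f \<in> measurable ?M ?M" by (rule measurable_restrict) measurable
  have "vol n (eball n r x) = emeasure (distr ?M ?M ?f) (eball n r x)"
    by (simp add: vol_def distr_translate_PiM_lborel)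
  also have "\<dots> = emeasure ?M (?f -` eball n r x \<inter> space ?M)"
    by (rule emeasure_distr) auto
  also have "?f -` eball n r x \<inter> space ?M = eball n r (\<lambda>_. 0)"
  proof -
    have "edist n x (?f y) = edist n (\<lambda>_. 0) y" for y by (rule edist_cong) simp
    then show ?thesis by (auto simp: eball_def space_PiM)
  qed
  finally show ?thesis using vol_eball_zero[OF assms] by (simp add: vol_def)
qed

lemma vol_box:
  assumes "\<And>i. i < n \<Longrightarrow> a i \<le> b i"
  shows "vol n (PiE {..<n} (\<lambda>i. {a i..b i})) = ennreal (\<Prod>i<n. b i - a i)"
    and "vol n (PiE {..<n} (\<lambda>i. {a i..<b i})) = ennreal (\<Prod>i<n. b i - a i)"
proof -
  have prod: "(\<Prod>i<n. ennreal (b i - a i)) = ennreal (\<Prod>i<n. b i - a i)"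
    using assms by (intro prod_ennreal) auto
  show "vol n (PiE {..<n} (\<lambda>i. {a i..b i})) = ennreal (\<Prod>i<n. b i - a i)"
    and "vol n (PiE {..<n} (\<lambda>i. {a i..<b i})) = ennreal (\<Prod>i<n. b i - a i)"
    unfolding vol_def prod[symmetric] using assms
    by (subst product_sigma_finite.emeasure_PiM[OF product_sigma_finite_lborel]; auto intro!: prod.cong)+
qed

text \<open>Half-open, so that the cells of distinct integer points are disjoint while every point
  still lies in the cell of its floor.\<close>

definition unit_cell :: "nat \<Rightarrow> (nat \<Rightarrow> int) \<Rightarrow> (nat \<Rightarrow> real) set" where
  "unit_cell n v = PiE {..<n} (\<lambda>i. {real_of_int (v i)..<real_of_int (v i) + 1})"

lemma unit_cell_sets: "unit_cell n v \<in> sets (PiM {..<n} (\<lambda>_. lborel))"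
  unfolding unit_cell_def by (intro sets_PiM_I_finite) auto

lemma vol_unit_cell: "vol n (unit_cell n v) = 1"
  unfolding unit_cell_def by (subst vol_box) auto

lemma edist_unit_cell: "y \<in> unit_cell n v \<Longrightarrow> edist n (emb v) y \<le> sqrt (real n)"
  by (rule edist_le_sqrt) (force simp: unit_cell_def PiE_iff abs_le_iff)

definition zfloor :: "nat \<Rightarrow> (nat \<Rightarrow> real) \<Rightarrow> nat \<Rightarrow> int" where
  "zfloor n y = (\<lambda>i\<in>{..<n}. \<lfloor>y i\<rfloor>)"

lemma zfloor_in: "zfloor n y \<in> zspace n"
  by (simp add: zfloor_def)

lemma edist_zfloor: "edist n (emb (zfloor n y)) y \<le> sqrt (real n)"
  by (rule edist_le_sqrt) (simp add: zfloor_def abs_le_iff, linarith)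

lemma in_unit_cell_zfloor: "y \<in> rspace n \<Longrightarrow> y \<in> unit_cell n (zfloor n y)"
  by (auto simp: unit_cell_def zfloor_def PiE_iff)

lemma disjoint_unit_cells: "disjoint_family_on (unit_cell n) (zspace n)"
unfolding disjoint_family_on_def
proof (intro ballI impI)
  fix v w assume vw: "v \<in> zspace n" "w \<in> zspace n" "v \<noteq> w"
  then obtain i where i: "i < n" "v i \<noteq> w i" by (metis PiE_ext lessThan_iff)
  then show "unit_cell n v \<inter> unit_cell n w = {}"
    by (force simp: unit_cell_def PiE_iff dest!: bspec[where x = i])
qed

text \<open>Counts and volumes agree up to a change of sqrt n in the radius: each point of the
  smaller ball lies in a cell of volume 1 whose corner is within sqrt n of it.
  \<open>card_zball_le\<close> is the reverse comparison, by disjointness of the cells.\<close>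

lemma card_zball_ge:
  assumes "sqrt (real n) < r"
  shows "unit_ball_vol (real n) * (r - sqrt (real n)) ^ n \<le> real (card (zball n (\<lambda>_. 0) r))"
proof -
  let ?M = "PiM {..<n} (\<lambda>_. lborel :: real measure)"
  have sub: "eball n (r - sqrt (real n)) (\<lambda>_. 0) \<subseteq> (\<Union>v\<in>zball n (\<lambda>_. 0) r. unit_cell n v)"
  proof
    fix y assume y: "y \<in> eball n (r - sqrt (real n)) (\<lambda>_. 0)"
    then have "edist n (emb (zfloor n y)) (\<lambda>_. 0) \<le> r"
      using edist_triangle[of n "emb (zfloor n y)" "\<lambda>_. 0" y] edist_zfloor[of n y]
      by (auto simp: eball_def edist_commute)
    then have "zfloor n y \<in> zball n (\<lambda>_. 0) r" by (simp add: zball_def zfloor_in)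
    then show "y \<in> (\<Union>v\<in>zball n (\<lambda>_. 0) r. unit_cell n v)"
      using in_unit_cell_zfloor[of y n] y by (auto simp: eball_def)
  qed
  have "ennreal (unit_ball_vol (real n) * (r - sqrt (real n)) ^ n) = emeasure ?M (eball n (r - sqrt (real n)) (\<lambda>_. 0))"
    using vol_eball_zero[of "r - sqrt (real n)" n] assms by (simp add: vol_def)
  also have "\<dots> \<le> emeasure ?M (\<Union>v\<in>zball n (\<lambda>_. 0) r. unit_cell n v)"
    by (intro emeasure_mono sub sets.finite_UN finite_zball unit_cell_sets)
  also have "\<dots> \<le> (\<Sum>v\<in>zball n (\<lambda>_. 0) r. emeasure ?M (unit_cell n v))"
    by (intro emeasure_subadditive_finite finite_zball) (auto simp: unit_cell_sets)
  also have "\<dots> = ennreal (real (card (zball n (\<lambda>_. 0) r)))"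
    using vol_unit_cell[of n] by (simp add: vol_def ennreal_of_nat_eq_real_of_nat)
  finally show ?thesis by simp
qed

lemma card_zball_le:
  assumes "0 \<le> r" "0 < n"
  shows "real (card (zball n (\<lambda>_. 0) r)) \<le> unit_ball_vol (real n) * (r + sqrt (real n)) ^ n"
proof -
  let ?M = "PiM {..<n} (\<lambda>_. lborel :: real measure)"
  have sub: "(\<Union>v\<in>zball n (\<lambda>_. 0) r. unit_cell n v) \<subseteq> eball n (r + sqrt (real n)) (\<lambda>_. 0)"
  proof
    fix y assume "y \<in> (\<Union>v\<in>zball n (\<lambda>_. 0) r. unit_cell n v)"
    then obtain v where v: "v \<in> zball n (\<lambda>_. 0) r" "y \<in> unit_cell n v" by auto
    then show "y \<in> eball n (r + sqrt (real n)) (\<lambda>_. 0)"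
      using edist_triangle[of n y "\<lambda>_. 0" "emb v"] edist_unit_cell[of y n v]
      by (auto simp: eball_def zball_def edist_commute unit_cell_def PiE_iff)
  qed
  have "ennreal (real (card (zball n (\<lambda>_. 0) r))) = (\<Sum>v\<in>zball n (\<lambda>_. 0) r. emeasure ?M (unit_cell n v))"
    using vol_unit_cell[of n] by (simp add: vol_def ennreal_of_nat_eq_real_of_nat)
  also have "\<dots> = emeasure ?M (\<Union>v\<in>zball n (\<lambda>_. 0) r. unit_cell n v)"
    by (intro sum_emeasure finite_zball disjoint_family_on_mono[OF zball_subset disjoint_unit_cells])
       (auto simp: unit_cell_sets)
  also have "\<dots> \<le> emeasure ?M (eball n (r + sqrt (real n)) (\<lambda>_. 0))"
    by (intro emeasure_mono sub eball_in_sets)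
  also have "\<dots> = ennreal (unit_ball_vol (real n) * (r + sqrt (real n)) ^ n)"
    using vol_eball_zero[of "r + sqrt (real n)" n] assms by (simp add: vol_def add_nonneg_pos)
  finally show ?thesis using assms by simp
qed

section \<open>Second moments of the integer ball\<close>

lemma sum_zball_coord_sq:
  assumes "i < n" "j < n"
  shows "(\<Sum>v\<in>zball n (\<lambda>_. 0) r. (real_of_int (v i))\<^sup>2) = (\<Sum>v\<in>zball n (\<lambda>_. 0) r. (real_of_int (v j))\<^sup>2)"
proof -
  let ?t = "Transposition.transpose i j"
  have p: "?t permutes {..<n}" using assms by (intro permutes_swap_id) auto
  have mem: "v \<circ> ?t \<in> zball n (\<lambda>_. 0) r" if "v \<in> zball n (\<lambda>_. 0) r" for v
  proof -
    have "v \<circ> ?t \<in> zspace n"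
      using that p by (auto simp: zball_def PiE_iff extensional_def permutes_def)
    moreover have "edist n (emb (v \<circ> ?t)) (\<lambda>_. 0) = edist n (emb v) (\<lambda>_. 0)"
      using sum.permute[OF p, of "\<lambda>k. (real_of_int (v k))\<^sup>2"]
      by (simp add: edist_def L2_set_def o_def)
    ultimately show ?thesis using that by (simp add: zball_def)
  qed
  show ?thesis
    by (rule sum.reindex_bij_witness[where i = "\<lambda>v. v \<circ> ?t" and j = "\<lambda>v. v \<circ> ?t"])
       (auto simp: mem comp_assoc fun_eq_iff)
qed

lemma sum_zball_coord_mult:
  assumes "i < n" "j < n" "i \<noteq> j"
  shows "(\<Sum>v\<in>zball n (\<lambda>_. 0) r. real_of_int (v i) * real_of_int (v j)) = 0"
proof -
  let ?S = "\<Sum>v\<in>zball n (\<lambda>_. 0) r. real_of_int (v i) * real_of_int (v j)"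
  let ?f = "\<lambda>v :: nat \<Rightarrow> int. v(i := - v i)"
  have mem: "?f v \<in> zball n (\<lambda>_. 0) r" if "v \<in> zball n (\<lambda>_. 0) r" for v
  proof -
    have "?f v \<in> zspace n" using that assms by (auto simp: zball_def PiE_iff extensional_def)
    moreover have "edist n (emb (?f v)) (\<lambda>_. 0) = edist n (emb v) (\<lambda>_. 0)"
      unfolding edist_def L2_set_def by (intro arg_cong[where f = sqrt] sum.cong) auto
    ultimately show ?thesis using that by (simp add: zball_def)
  qed
  have "?S = (\<Sum>v\<in>zball n (\<lambda>_. 0) r. - (real_of_int (v i) * real_of_int (v j)))"
    using assms by (intro sum.reindex_bij_witness[where i = ?f and j = ?f]) (auto simp: mem)
  also have "\<dots> = - ?S" by (simp add: sum_negf)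
  finally show ?thesis by simp
qed

text \<open>Exchanging two coordinates and flipping one sign both preserve the ball, so its second
  moment matrix is \<open>M\<close> times the identity. The trace \<open>n * M\<close> is the sum of
  the squared norms, each at most \<open>r\<^sup>2\<close>.\<close>

lemma sum_zball_inner_sq_le:
  assumes "0 \<le> r"
  shows "real n * (\<Sum>v\<in>zball n (\<lambda>_. 0) r. (\<Sum>i<n. real_of_int (v i) * h i)\<^sup>2)
    \<le> (\<Sum>i<n. (h i)\<^sup>2) * r\<^sup>2 * real (card (zball n (\<lambda>_. 0) r))"
proof (cases "n = 0")
  case False
  let ?B = "zball n (\<lambda>_. 0) r"
  define M where "M = (\<Sum>v\<in>?B. (real_of_int (v 0))\<^sup>2)"
  have M: "(\<Sum>v\<in>?B. real_of_int (v i) * real_of_int (v j)) = (if i = j then M else 0)"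
    if "i < n" "j < n" for i j
    using that False sum_zball_coord_sq[of i n 0] sum_zball_coord_mult[of i n j]
    by (auto simp: M_def power2_eq_square)
  have "(\<Sum>v\<in>?B. (\<Sum>i<n. real_of_int (v i) * h i)\<^sup>2)
      = (\<Sum>v\<in>?B. \<Sum>i<n. \<Sum>j<n. (h i * h j) * (real_of_int (v i) * real_of_int (v j)))"
    by (simp add: power2_eq_square sum_product mult_ac)
  also have "\<dots> = (\<Sum>i<n. \<Sum>v\<in>?B. \<Sum>j<n. (h i * h j) * (real_of_int (v i) * real_of_int (v j)))"
    by (rule sum.swap)
  also have "\<dots> = (\<Sum>i<n. \<Sum>j<n. (h i * h j) * (\<Sum>v\<in>?B. real_of_int (v i) * real_of_int (v j)))"
    unfolding sum_distrib_left by (intro sum.cong refl sum.swap)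
  also have "\<dots> = (\<Sum>i<n. \<Sum>j<n. if i = j then (h i * h j) * M else 0)"
    by (intro sum.cong refl) (auto simp: M)
  also have "\<dots> = (\<Sum>i<n. (h i)\<^sup>2) * M"
    by (simp add: sum.delta power2_eq_square sum_distrib_right)
  finally have 1: "(\<Sum>v\<in>?B. (\<Sum>i<n. real_of_int (v i) * h i)\<^sup>2) = (\<Sum>i<n. (h i)\<^sup>2) * M" .
  have "real n * M = (\<Sum>i<n. \<Sum>v\<in>?B. (real_of_int (v i))\<^sup>2)"
    using M by (simp add: power2_eq_square)
  also have "\<dots> = (\<Sum>v\<in>?B. \<Sum>i<n. (real_of_int (v i))\<^sup>2)" by (rule sum.swap)
  also have "\<dots> \<le> (\<Sum>v\<in>?B. r\<^sup>2)"
  proof (rule sum_mono)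
    fix v assume "v \<in> ?B"
    then have "(edist n (emb v) (\<lambda>_. 0))\<^sup>2 \<le> r\<^sup>2" by (intro power_mono) (auto simp: zball_def)
    then show "(\<Sum>i<n. (real_of_int (v i))\<^sup>2) \<le> r\<^sup>2"
      by (simp add: edist_def L2_set_def sum_nonneg)
  qed
  also have "\<dots> = r\<^sup>2 * real (card ?B)" by simp
  finally have "real n * M \<le> r\<^sup>2 * real (card ?B)" .
  then have "(\<Sum>i<n. (h i)\<^sup>2) * (real n * M) \<le> (\<Sum>i<n. (h i)\<^sup>2) * (r\<^sup>2 * real (card ?B))"
    by (intro mult_left_mono sum_nonneg) auto
  then show ?thesis unfolding 1 by (simp add: mult_ac)
qed simp

text \<open>A point of the ball around \<open>t\<close> that leaves the ball around \<open>t + h\<close> has a large inner product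
  with \<open>h\<close>, which Chebyshev's inequality makes rare.\<close>

lemma card_zball_diff_le:
  fixes t w :: "nat \<Rightarrow> int"
  assumes "0 \<le> r" "0 \<le> s" "0 < \<theta>" and h: "edist n (emb w) (emb t) \<le> d"
    and le: "r\<^sup>2 + \<theta> + d\<^sup>2 \<le> s\<^sup>2"
  shows "real n * \<theta>\<^sup>2 * real (card (zball n (emb t) r - zball n (emb w) s))
    \<le> 4 * d\<^sup>2 * r\<^sup>2 * real (card (zball n (\<lambda>_. 0) r))"
proof -
  define h where "h i = real_of_int (w i) - real_of_int (t i)" for i
  let ?B = "zball n (\<lambda>_. 0) r"
  let ?K = "{v \<in> ?B. \<theta> \<le> 2 * \<bar>\<Sum>i<n. real_of_int (v i) * h i\<bar>}"
  have hd: "(\<Sum>i<n. (h i)\<^sup>2) \<le> d\<^sup>2"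
  proof -
    have "(edist n (emb w) (emb t))\<^sup>2 \<le> d\<^sup>2" using h by (intro power_mono) auto
    then show ?thesis by (simp add: edist_def L2_set_def sum_nonneg h_def)
  qed
  have "zball n (emb t) r - zball n (emb w) s \<subseteq> zshift n t ` ?K"
  proof
    fix v assume v: "v \<in> zball n (emb t) r - zball n (emb w) s"
    then have "v \<in> zshift n t ` ?B" using zshift_image_zball[of n t "\<lambda>_. 0" r] by simp
    then obtain v' where v': "v' \<in> ?B" "v = zshift n t v'" by auto
    have "edist n (emb v) (emb w) = edist n (emb v') h"
      unfolding v' by (rule edist_cong) (simp add: h_def)
    moreover have "\<not> edist n (emb v) (emb w) \<le> s"
      using v by (metis (no_types, lifting) DiffE mem_Collect_eq zball_def)
    ultimately have "s < edist n (emb v') h" by simp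
    then have "s\<^sup>2 < (edist n (emb v') h)\<^sup>2" using assms by (intro power_strict_mono) auto
    also have "\<dots> = (\<Sum>i<n. (real_of_int (v' i))\<^sup>2 - 2 * (real_of_int (v' i) * h i) + (h i)\<^sup>2)"
      by (simp add: edist_power2 power2_diff algebra_simps)
    also have "\<dots> = (\<Sum>i<n. (real_of_int (v' i))\<^sup>2) - 2 * (\<Sum>i<n. real_of_int (v' i) * h i) + (\<Sum>i<n. (h i)\<^sup>2)"
      by (simp add: sum.distrib sum_subtractf sum_distrib_left)
    also have "(\<Sum>i<n. (real_of_int (v' i))\<^sup>2) \<le> r\<^sup>2"
    proof -
      have "(edist n (emb v') (\<lambda>_. 0))\<^sup>2 \<le> r\<^sup>2" using v' by (intro power_mono) (auto simp: zball_def)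
      then show ?thesis by (simp add: edist_def L2_set_def sum_nonneg)
    qed
    \<comment> \<open>The squared lengths of \<open>v'\<close> and \<open>h\<close> are at most
      \<open>r\<^sup>2\<close> and \<open>d\<^sup>2\<close>; the remaining part of
      \<open>s\<^sup>2\<close>, at least \<open>\<theta>\<close>, must come from the cross
      term.\<close>
    finally have "\<theta> \<le> 2 * \<bar>\<Sum>i<n. real_of_int (v' i) * h i\<bar>" using le hd by linarith
    with v' show "v \<in> zshift n t ` ?K" by blast
  qed
  then have "card (zball n (emb t) r - zball n (emb w) s) \<le> card (zshift n t ` ?K)"
    by (intro card_mono finite_imageI) (auto simp: finite_zball)
  also have "\<dots> \<le> card ?K" by (intro card_image_le) (auto simp: finite_zball)
  finally have "real n * \<theta>\<^sup>2 * real (card (zball n (emb t) r - zball n (emb w) s)) \<le> real n * \<theta>\<^sup>2 * real (card ?K)"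
    by (intro mult_left_mono) auto
  also have "\<dots> = real n * (\<Sum>v\<in>?K. \<theta>\<^sup>2)" by simp
  \<comment> \<open>Chebyshev: the square is at least \<open>\<theta>\<^sup>2\<close> on
    \<open>?K\<close>, and summing it over the whole ball brings in the second moment.\<close>
  also have "\<dots> \<le> real n * (\<Sum>v\<in>?K. (2 * \<bar>\<Sum>i<n. real_of_int (v i) * h i\<bar>)\<^sup>2)"
    using assms by (intro mult_left_mono sum_mono power_mono) auto
  also have "\<dots> \<le> real n * (\<Sum>v\<in>?B. (2 * \<bar>\<Sum>i<n. real_of_int (v i) * h i\<bar>)\<^sup>2)"
    by (intro mult_left_mono sum_mono2) (auto simp: finite_zball)
  also have "\<dots> = 4 * (real n * (\<Sum>v\<in>?B. (\<Sum>i<n. real_of_int (v i) * h i)\<^sup>2))"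
    by (simp add: power_mult_distrib sum_distrib_left mult.left_commute)
  also have "\<dots> \<le> 4 * ((\<Sum>i<n. (h i)\<^sup>2) * r\<^sup>2 * real (card ?B))"
    using sum_zball_inner_sq_le[of r n h] assms by simp
  also have "\<dots> \<le> 4 * (d\<^sup>2 * r\<^sup>2 * real (card ?B))"
    using hd by (intro mult_left_mono mult_right_mono) auto
  finally show ?thesis by (simp add: mult_ac)
qed

section \<open>Congruence lattices without short vectors\<close>

section \<open>The torus and its nets\<close>

text \<open>The quotient map of the integer points by the lattice given by \<open>v i\<close>
  congruent to \<open>a i * v 0\<close> modulo \<open>p\<close>. Coordinate 0 is free, so the
  classes are tuples of n - 1 residues and the index is p^(n-1).\<close>

definition latmap :: "int \<Rightarrow> (nat \<Rightarrow> int) \<Rightarrow> nat \<Rightarrow> (nat \<Rightarrow> int) \<Rightarrow> nat \<Rightarrow> int" where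
  "latmap p a n v = (\<lambda>i\<in>{1..<n}. (v i - a i * v 0) mod p)"

definition residues :: "int \<Rightarrow> nat \<Rightarrow> (nat \<Rightarrow> int) set" where
  "residues p n = PiE {1..<n} (\<lambda>_. {0..<p})"

lemma finite_residues: "finite (residues p n)"
  unfolding residues_def by (intro finite_PiE) auto

lemma card_residues: "card (residues p n) = nat p ^ (n - 1)"
  by (simp add: residues_def card_PiE)

lemma latmap_in_residues: "0 < p \<Longrightarrow> latmap p a n v \<in> residues p n"
  by (auto simp: latmap_def residues_def)

lemma latmap_eq_iff:
  "latmap p a n v = latmap p a n w \<longleftrightarrow> (\<forall>i\<in>{1..<n}. p dvd (v i - w i) - a i * (v 0 - w 0))"
proof -
  have "latmap p a n v = latmap p a n w \<longleftrightarrow>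
      (\<forall>i\<in>{1..<n}. (v i - a i * v 0) mod p = (w i - a i * w 0) mod p)"
    by (auto simp: latmap_def restrict_def fun_eq_iff)
  moreover have "(v i - a i * v 0) - (w i - a i * w 0) = (v i - w i) - a i * (v 0 - w 0)" for i
    by (simp add: algebra_simps)
  ultimately show ?thesis by (simp add: mod_eq_dvd_iff)
qed

text \<open>\<open>w - v\<close> is a lattice vector, and shifting by it changes no class. This is
  how a point is replaced by another representative near a prescribed place.\<close>

lemma latmap_zshift_diff:
  assumes "latmap p a n v = latmap p a n w" "0 < n"
  shows "latmap p a n (zshift n (\<lambda>i. w i - v i) x) = latmap p a n x"
proof -
  have "p dvd - ((v i - w i) - a i * (v 0 - w 0))" if "i \<in> {1..<n}" for i
    using assms(1) that unfolding latmap_eq_iff by (simp only: dvd_minus_iff)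
  then show ?thesis
    using assms(2) unfolding latmap_eq_iff by (simp add: algebra_simps)
qed

lemma abs_less_dvd_imp_zero: "p dvd x \<Longrightarrow> \<bar>x\<bar> < p \<Longrightarrow> x = (0::int)"
  using zdvd_imp_le[of p "\<bar>x\<bar>"] by fastforce

text \<open>A short vector with \<open>v 0\<close> nonzero lies in the lattice of at most one
  \<open>a\<close>, because \<open>v 0\<close> is invertible modulo \<open>p\<close>; there are
  fewer short vectors than parameters, so some \<open>a\<close> avoids them all. A lattice vector
  with first coordinate 0 has all coordinates divisible by \<open>p\<close>, and if it is short it
  vanishes.\<close>

lemma ex_separated_lattice:
  assumes p: "prime p" and r: "r < real_of_int p" and n: "0 < n"
    and card: "card (zball n (\<lambda>_. 0) r) < nat p ^ (n - 1)"
  shows "\<exists>a. \<forall>v\<in>zspace n. \<forall>w\<in>zspace n.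
    latmap p a n v = latmap p a n w \<longrightarrow> edist n (emb v) (emb w) \<le> r \<longrightarrow> v = w"
proof -
  let ?B = "{v \<in> zball n (\<lambda>_. 0) r. v 0 \<noteq> 0}"
  define K where "K v = {a \<in> residues p n. \<forall>i\<in>{1..<n}. p dvd v i - a i * v 0}" for v
  have small: "\<bar>v i\<bar> < p" if "v \<in> zball n (\<lambda>_. 0) r" "i < n" for v i
  proof -
    have "\<bar>real_of_int (v i)\<bar> \<le> r"
      using abs_diff_le_edist[OF that(2), of "emb v" "\<lambda>_. 0"] that(1) by (simp add: zball_def)
    then show ?thesis using r by linarith
  qed
  have K: "card (K v) \<le> 1" if v: "v \<in> ?B" for v
  proof -
    have "a = a'" if "a \<in> K v" "a' \<in> K v" for a a'
    proof (rule PiE_ext)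
      show "a \<in> PiE {1..<n} (\<lambda>_. {0..<p})" "a' \<in> PiE {1..<n} (\<lambda>_. {0..<p})"
        using that by (auto simp: K_def residues_def)
      fix i assume i: "i \<in> {1..<n}"
      have "p dvd (v i - a i * v 0) - (v i - a' i * v 0)"
        using that i unfolding K_def by - (rule dvd_diff, blast+)
      then have "p dvd (a' i - a i) * v 0" by (simp add: algebra_simps)
      moreover have "\<not> p dvd v 0"
        using abs_less_dvd_imp_zero[of p "v 0"] small[of v 0] v n by auto
      ultimately have "p dvd a' i - a i" using p by (simp add: prime_dvd_mult_iff)
      moreover have "\<bar>a' i - a i\<bar> < p"
      proof -
        have "a i \<in> {0..<p}" "a' i \<in> {0..<p}"
          using that i unfolding K_def residues_def by (auto dest!: PiE_mem[where x = i])
        then show ?thesis by auto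
      qed
      ultimately show "a i = a' i" using abs_less_dvd_imp_zero[of p "a' i - a i"] by simp
    qed
    moreover have "finite (K v)" by (simp add: K_def finite_residues)
    ultimately show ?thesis by (simp add: card_le_Suc0_iff_eq)
  qed
  have "card (\<Union>v\<in>?B. K v) \<le> (\<Sum>v\<in>?B. card (K v))"
    by (intro card_UN_le) (simp add: finite_zball)
  also have "\<dots> \<le> (\<Sum>v\<in>?B. 1)" by (intro sum_mono K)
  also have "\<dots> \<le> card (zball n (\<lambda>_. 0) r)" by (simp add: card_mono finite_zball)
  also have "\<dots> < card (residues p n)" using card by (simp add: card_residues)
  finally have "\<not> residues p n \<subseteq> (\<Union>v\<in>?B. K v)"
    using card_mono[of "\<Union>v\<in>?B. K v" "residues p n"] by (force simp: K_def finite_zball finite_residues)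
  then obtain a where a: "a \<in> residues p n" "\<And>v. v \<in> ?B \<Longrightarrow> a \<notin> K v" by blast
  show ?thesis
  proof (intro exI ballI impI)
    fix v w assume v: "v \<in> zspace n" and w: "w \<in> zspace n"
      and eq: "latmap p a n v = latmap p a n w" and d: "edist n (emb v) (emb w) \<le> r"
    define x where "x = zshift n (\<lambda>i. - w i) v"
    have "edist n (emb x) (\<lambda>_. 0) = edist n (emb v) (emb w)"
      by (rule edist_cong) (simp add: x_def)
    with d have x: "x \<in> zball n (\<lambda>_. 0) r" by (simp only: zball_def x_def zshift_in mem_Collect_eq)
    have dvd: "p dvd x i - a i * x 0" if "i \<in> {1..<n}" for i
      using eq that n unfolding latmap_eq_iff by (simp add: x_def)
    then have "x 0 = 0" using a x unfolding K_def by blast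
    moreover have "x i = 0" if "i \<in> {1..<n}" for i
      using dvd[OF that] \<open>x 0 = 0\<close> small[OF x, of i] that by (auto intro: abs_less_dvd_imp_zero)
    ultimately have "x i = 0" if "i < n" for i using that by (cases "i = 0") auto
    then have "v i = w i" if "i < n" for i using that by (simp add: x_def)
    then show "v = w" using v w by (intro PiE_ext[of v "{..<n}" _ w]) auto
  qed
qed

text \<open>Solving the index equation for \<open>R\<close> makes it grow like p^((n-1)/n): without
  bound, but more slowly than \<open>p\<close>. Hence a large prime meets both inequalities.\<close>

lemma ex_prime_radius:
  assumes n: "2 \<le> n"
  shows "\<exists>p R. prime (p :: int) \<and> R0 \<le> R \<and> 3 * R < real_of_int p \<and>
    unit_ball_vol (real n) * (4 * R) ^ n = real_of_int p ^ (n - 1)"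
proof -
  let ?w = "unit_ball_vol (real n)"
  have w: "0 < ?w" by simp
  \<comment> \<open>The first entry of the maximum will give \<open>3 * R < p\<close>, the second
    \<open>R0 \<le> R\<close>.\<close>
  obtain p :: nat where p: "prime p" "nat \<lceil>max (1 / ?w) (?w * (4 * R0) ^ n)\<rceil> < p"
    using bigger_prime by blast
  then have p': "1 / ?w < real p" "?w * (4 * R0) ^ n < real p" by linarith+
  have p0: "1 \<le> real p" using prime_gt_0_nat[OF p(1)] by simp
  define R where "R = root n (real p ^ (n - 1) / ?w) / 4"
  have eq: "?w * (4 * R) ^ n = real p ^ (n - 1)"
    using n less_imp_neq[OF w] by (simp add: R_def)
  have R0: "0 \<le> R" by (simp add: R_def real_root_ge_zero)
  have "R0 \<le> R"
  proof (rule ccontr)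
    assume "\<not> R0 \<le> R"
    then have "(4 * R) ^ n \<le> (4 * R0) ^ n" using R0 by (intro power_mono) auto
    then have "?w * (4 * R) ^ n \<le> ?w * (4 * R0) ^ n" using w by simp
    also have "\<dots> < real p" by (rule p')
    also have "\<dots> \<le> real p ^ (n - 1)" using n p0 by (intro self_le_power) auto
    finally show False using eq by simp
  qed
  moreover have "3 * R < real p"
  proof (rule ccontr)
    assume "\<not> 3 * R < real p"
    then have "real p ^ n \<le> (4 * R) ^ n" using R0 by (intro power_mono) auto
    then have "?w * real p ^ n \<le> real p ^ (n - 1)" using w eq by (metis mult_le_cancel_left_pos)
    moreover have "real p ^ n = real p * real p ^ (n - 1)" using n by (simp add: power_eq_if)
    moreover have "1 * real p ^ (n - 1) < (?w * real p) * real p ^ (n - 1)"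
      using p'(1) w p0 by (intro mult_strict_right_mono) (auto simp: field_simps)
    ultimately show False by (simp add: mult_ac)
  qed
  ultimately show ?thesis using p(1) eq
    by (intro exI[of _ "int p"] exI[of _ R]) auto
qed

text \<open>By \<open>sep\<close> no nonzero lattice vector is shorter than \<open>3 * R\<close>, so
  balls of radius up to \<open>3 * R / 2\<close> embed into the torus. By \<open>index\<close> the
  torus is 4^n times as large as a ball of radius \<open>R\<close>, an exponential factor that is
  negligible against powers of n^n.\<close>

locale ball_torus =
  fixes n :: nat and p :: int and a :: "nat \<Rightarrow> int" and R :: real
  assumes n: "2 \<le> n" and p: "0 < p"
    and sep: "\<And>v w. v \<in> zspace n \<Longrightarrow> w \<in> zspace n \<Longrightarrow> latmap p a n v = latmap p a n w \<Longrightarrow>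
      edist n (emb v) (emb w) \<le> 3 * R \<Longrightarrow> v = w"
    and R: "0 < R"
    and index: "unit_ball_vol (real n) * (4 * R) ^ n = real_of_int p ^ (n - 1)"
begin

abbreviation phi where "phi \<equiv> latmap p a n"
abbreviation G where "G \<equiv> residues p n"
abbreviation w where "w \<equiv> unit_ball_vol (real n)"

lemma card_G: "real (card G) = w * (4 * R) ^ n"
  using p unfolding index by (simp add: card_residues)

lemma G_nonempty: "G \<noteq> {}"
  using latmap_in_residues[OF p] by blast

lemma inj_on_phi: "2 * r \<le> 3 * R \<Longrightarrow> inj_on phi (zball n x r)"
proof (rule inj_onI)
  fix v v' assume r: "2 * r \<le> 3 * R" and v: "v \<in> zball n x r" "v' \<in> zball n x r" "phi v = phi v'"
  then have "edist n (emb v) (emb v') \<le> 3 * R"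
    using edist_triangle[of n "emb v" "emb v'" x] edist_commute[of n x "emb v'"]
    by (simp add: zball_def)
  then show "v = v'" using v sep zball_subset by blast
qed

lemma card_phi_zball: "2 * r \<le> 3 * R \<Longrightarrow> card (phi ` zball n (emb u) r) = card (zball n (\<lambda>_. 0) r)"
  by (simp add: card_image inj_on_phi card_zball_emb)

lemma phi_image_zball_eq:
  assumes "phi u = phi v"
  shows "phi ` zball n (emb u) r = phi ` zball n (emb v) r"
proof -
  have "zball n (emb v) r = zshift n (\<lambda>i. v i - u i) ` zball n (emb u) r"
    by (subst zshift_image_zball) (intro zball_cong, simp)
  then show ?thesis using latmap_zshift_diff[OF assms] n by (simp add: image_image)
qed

lemma self_in_zball: "u \<in> zspace n \<Longrightarrow> 0 \<le> r \<Longrightarrow> u \<in> zball n (emb u) r"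
  by (simp only: zball_def mem_Collect_eq edist_self)

text \<open>Take a maximal family of disjoint \<open>d\<close>-balls in the torus. Disjointness
  bounds its size; by maximality every \<open>d\<close>-ball meets one of the family, so each class
  has a representative \<open>v'\<close> within \<open>2 * d\<close> of a centre.\<close>

lemma ex_net:
  assumes d: "0 \<le> d" "2 * d \<le> 3 * R"
  shows "\<exists>U. U \<subseteq> zspace n \<and> finite U \<and> card U * card (zball n (\<lambda>_. 0) d) \<le> card G \<and>
    (\<forall>v\<in>zspace n. \<exists>u\<in>U. \<exists>v'\<in>zspace n. phi v' = phi v \<and> edist n (emb v') (emb u) \<le> 2 * d)"
proof -
  define Q where "Q U \<longleftrightarrow> U \<subseteq> zspace n \<and> finite U \<and> disjoint_family_on (\<lambda>u. phi ` zball n (emb u) d) U" for U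
  have bound: "card U * card (zball n (\<lambda>_. 0) d) \<le> card G" if "Q U" for U
  proof -
    have "card U * card (zball n (\<lambda>_. 0) d) = (\<Sum>u\<in>U. card (phi ` zball n (emb u) d))"
      using d by (simp add: card_phi_zball)
    also have "\<dots> = card (\<Union>u\<in>U. phi ` zball n (emb u) d)"
      using that by (intro card_UN_disjoint[symmetric]) (auto simp: Q_def disjoint_family_on_def finite_zball)
    also have "\<dots> \<le> card G"
      using latmap_in_residues[OF p] by (intro card_mono finite_residues) auto
    finally show ?thesis .
  qed
  have pos: "1 \<le> card (zball n (\<lambda>_. 0) d)"
  proof -
    \<comment> \<open>This shift of \<open>undefined\<close> is merely some point of
      \<open>zspace n\<close>; the constant function 0 is not extensional. Nonempty balls bound the
      size of the families, so a largest one exists.\<close>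
    have "zball n (emb (zshift n (\<lambda>_. 0) undefined)) d \<noteq> {}"
      using self_in_zball[OF zshift_in d(1)] by blast
    then show ?thesis
      by (simp add: card_zball_emb[symmetric, of n d "zshift n (\<lambda>_. 0) undefined"] Suc_le_eq card_gt_0_iff finite_zball)
  qed
  have "card U \<le> card G" if "Q U" for U
    using bound[OF that] pos by (metis le_trans mult.right_neutral mult_le_mono2)
  moreover have "Q {}" by (simp add: Q_def disjoint_family_on_def)
  ultimately obtain U where U: "Q U" and max: "\<And>V. Q V \<Longrightarrow> card V \<le> card U"
    using ex_has_greatest_nat[of Q "{}" card "Suc (card G)"] by (metis le_imp_less_Suc)
  show ?thesis
  proof (intro exI[of _ U] conjI ballI)
    show "U \<subseteq> zspace n" "finite U" using U by (simp_all add: Q_def)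
    show "card U * card (zball n (\<lambda>_. 0) d) \<le> card G" by (rule bound[OF U])
    fix v assume v: "v \<in> zspace n"
    have "\<exists>u\<in>U. phi ` zball n (emb v) d \<inter> phi ` zball n (emb u) d \<noteq> {}"
    proof (cases "v \<in> U")
      case True
      then show ?thesis using self_in_zball[OF v d(1)] by blast
    next
      case False
      show ?thesis
      proof (rule ccontr)
        assume neg: "\<not> ?thesis"
        have "Q (insert v U)"
          using U neg v False unfolding Q_def disjoint_family_on_def by (simp add: Int_commute)
        then show False using max[of "insert v U"] False U by (simp add: Q_def)
      qed
    qed
    then obtain u c where u: "u \<in> U" and "c \<in> phi ` zball n (emb v) d" "c \<in> phi ` zball n (emb u) d"
      by blast
    then obtain x y where x: "x \<in> zball n (emb v) d" and y: "y \<in> zball n (emb u) d"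
      and eq: "phi x = phi y" by blast
    define v' where "v' = zshift n (\<lambda>i. y i - x i) v"
    have "phi v' = phi v" unfolding v'_def using latmap_zshift_diff[OF eq] n by simp
    moreover have "edist n (emb v') (emb u) \<le> 2 * d"
    proof -
      have "edist n (emb v') (emb u) \<le> edist n (emb v') (emb y) + edist n (emb y) (emb u)"
        by (rule edist_triangle)
      moreover have "edist n (emb v') (emb y) = edist n (emb v) (emb x)"
        by (rule edist_cong) (simp add: v'_def)
      ultimately show ?thesis using x y edist_commute[of n "emb v" "emb x"] by (simp add: zball_def)
    qed
    ultimately show "\<exists>u\<in>U. \<exists>v'\<in>zspace n. phi v' = phi v \<and> edist n (emb v') (emb u) \<le> 2 * d"
      using u zshift_in[of n] unfolding v'_def by blast
  qed
qed

text \<open>Passes from net points to all real centres \<open>y\<close>: rounding to an integer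
  point costs sqrt n and moving to the net costs \<open>d\<close>. So, up to a lattice translation,
  the ball around \<open>y\<close> lies between the shrunken and the enlarged ball around some
  \<open>u\<close>.\<close>

lemma cover_from_net:
  fixes N :: nat
  assumes net: "\<And>v. v \<in> zspace n \<Longrightarrow> \<exists>u\<in>U. \<exists>v'\<in>zspace n. phi v' = phi v \<and> edist n (emb v') (emb u) \<le> d"
    and small: "2 * (R + d + sqrt (real n)) \<le> 3 * R"
    and many: "\<And>u. u \<in> U \<Longrightarrow> real (card {i\<in>{..<N}. f i \<in> phi ` zball n (emb u) (R + d + sqrt (real n))}) \<le> m"
    and some: "\<And>u. u \<in> U \<Longrightarrow> \<exists>i<N. f i \<in> phi ` zball n (emb u) (R - d - sqrt (real n))"
  shows "real (card {v \<in> zball n y R. phi v \<in> f ` {..<N}}) \<le> m"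
    and "\<exists>v\<in>zball n y R. phi v \<in> f ` {..<N}"
proof -
  define v0 where "v0 = zfloor n y"
  obtain u v' where u: "u \<in> U" and v': "v' \<in> zspace n" "phi v' = phi v0" "edist n (emb v') (emb u) \<le> d"
    using net[of v0] zfloor_in[of n y] unfolding v0_def by blast
  \<comment> \<open>The translate of \<open>y\<close> by the lattice vector that carries its
    rounding \<open>v0\<close> to the representative \<open>v'\<close> near
    \<open>u\<close>.\<close>
  define y' where "y' i = y i + real_of_int (v' i - v0 i)" for i
  have y'u: "edist n y' (emb u) \<le> d + sqrt (real n)"
  proof -
    have "edist n y' (emb v') = edist n y (emb v0)" by (rule edist_cong) (simp add: y'_def)
    also have "\<dots> \<le> sqrt (real n)" using edist_zfloor[of n y] by (simp add: edist_commute v0_def)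
    finally show ?thesis using edist_triangle[of n y' "emb u" "emb v'"] v'(3) by linarith
  qed
  have img: "zshift n (\<lambda>i. v' i - v0 i) ` zball n y R = zball n y' R"
    by (simp add: zshift_image_zball y'_def[abs_def])
  have phi_shift: "phi (zshift n (\<lambda>i. v' i - v0 i) x) = phi x" for x
    using latmap_zshift_diff[OF v'(2)[symmetric]] n by simp
  let ?D = "phi ` zball n (emb u) (R + d + sqrt (real n))"
  have sub: "zball n y' R \<subseteq> zball n (emb u) (R + d + sqrt (real n))"
    using y'u by (intro zball_subset_zball) simp
  have "card {v \<in> zball n y R. phi v \<in> f ` {..<N}}
      = card (zshift n (\<lambda>i. v' i - v0 i) ` {v \<in> zball n y R. phi v \<in> f ` {..<N}})"
    by (rule card_image[symmetric], rule inj_on_subset[OF inj_on_zshift]) (use zball_subset in blast)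
  also have "zshift n (\<lambda>i. v' i - v0 i) ` {v \<in> zball n y R. phi v \<in> f ` {..<N}}
      \<subseteq> {v \<in> zball n y' R. phi v \<in> f ` {..<N}}"
    using img phi_shift by auto
  then have "card (zshift n (\<lambda>i. v' i - v0 i) ` {v \<in> zball n y R. phi v \<in> f ` {..<N}})
      \<le> card {v \<in> zball n y' R. phi v \<in> f ` {..<N}}"
    by (rule card_mono[rotated]) (simp add: finite_zball)
  also have "\<dots> = card (phi ` {v \<in> zball n y' R. phi v \<in> f ` {..<N}})"
    by (rule card_image[symmetric], rule inj_on_subset[OF inj_on_phi[OF small]]) (use sub in blast)
  \<comment> \<open>Several indices may select the same class, so the number of selected classes in
    \<open>?D\<close> is at most the number of indices hitting it.\<close>
  also have "\<dots> \<le> card (f ` {i\<in>{..<N}. f i \<in> ?D})"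
  proof (intro card_mono)
    show "phi ` {v \<in> zball n y' R. phi v \<in> f ` {..<N}} \<subseteq> f ` {i\<in>{..<N}. f i \<in> ?D}"
    proof
      fix c assume "c \<in> phi ` {v \<in> zball n y' R. phi v \<in> f ` {..<N}}"
      then obtain v i where v: "c = phi v" "v \<in> zball n y' R" "phi v = f i" "i < N" by blast
      with sub have "f i \<in> ?D" by (metis image_eqI subsetD)
      with v show "c \<in> f ` {i\<in>{..<N}. f i \<in> ?D}" by simp
    qed
  qed simp
  also have "\<dots> \<le> card {i\<in>{..<N}. f i \<in> ?D}" by (rule card_image_le) simp
  finally have "real (card {v \<in> zball n y R. phi v \<in> f ` {..<N}}) \<le> real (card {i\<in>{..<N}. f i \<in> ?D})"
    by (rule of_nat_mono)
  then show "real (card {v \<in> zball n y R. phi v \<in> f ` {..<N}}) \<le> m" using many[OF u] by simp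
  obtain i x where i: "i < N" "f i = phi x" and x: "x \<in> zball n (emb u) (R - d - sqrt (real n))"
    using some[OF u] by auto
  have "x \<in> zball n y' R"
  proof -
    have "zball n (emb u) (R - d - sqrt (real n)) \<subseteq> zball n y' R"
      using y'u by (intro zball_subset_zball) (simp add: edist_commute)
    then show ?thesis using x by blast
  qed
  then obtain x' where x': "x' \<in> zball n y R" "x = zshift n (\<lambda>i. v' i - v0 i) x'"
    unfolding img[symmetric] by blast
  have "phi x' = f i" using i phi_shift[of x'] x'(2) by simp
  with i x'(1) show "\<exists>v\<in>zball n y R. phi v \<in> f ` {..<N}" by blast
qed

end

section \<open>Net sizes and the random selection of classes\<close>

context ball_torus
begin

text \<open>Since sqrt n is at most \<open>d / 2\<close>, each packed ball still counts at least the
  volume of a ball of radius \<open>\<delta> * R\<close>. The torus has volume 4^n times that of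
  radius \<open>R\<close>.\<close>

lemma card_net_le:
  assumes "real (card U * card (zball n (\<lambda>_. 0) d)) \<le> real (card G)"
    and "2 * sqrt (real n) \<le> d" "0 < \<delta>" "\<delta> * R \<le> d / 2"
  shows "real (card U) \<le> (4 / \<delta>) ^ n"
proof -
  have "w * (\<delta> * R) ^ n \<le> w * (d - sqrt (real n)) ^ n"
    using assms R by (intro mult_left_mono power_mono) auto
  also have "\<dots> \<le> real (card (zball n (\<lambda>_. 0) d))"
  proof (rule card_zball_ge)
    have "0 < sqrt (real n)" using n by simp
    then show "sqrt (real n) < d" using assms(2) by linarith
  qed
  finally have "real (card U) * (w * (\<delta> * R) ^ n) \<le> real (card U) * real (card (zball n (\<lambda>_. 0) d))"
    by (rule mult_left_mono) simp
  also have "\<dots> \<le> w * (4 * R) ^ n" using assms(1) by (simp add: card_G)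
  finally have "(real (card U) * \<delta> ^ n) * (w * R ^ n) \<le> 4 ^ n * (w * R ^ n)"
    by (simp add: power_mult_distrib mult_ac)
  then have "real (card U) * \<delta> ^ n \<le> 4 ^ n" using R by (simp add: mult_le_cancel_right_pos)
  then show ?thesis using assms(3) by (simp add: power_divide field_simps)
qed

text \<open>Applies \<open>random_choice_exists\<close> in the torus: \<open>D\<close> are enlarged
  balls for the multiplicity, \<open>C\<close> shrunken balls for the covering, and \<open>E\<close>
  still smaller balls around coarse net points, which supply the candidates for covering nearby fine
  points.\<close>

lemma ex_covering_classes:
  fixes \<alpha> \<beta> \<gamma> q z v m k :: real and N :: nat
  defines "\<kappa> \<equiv> 4 * \<alpha> + \<gamma> + \<beta>\<^sup>2"
  assumes par: "0 < \<alpha>" "\<alpha> \<le> 1 / 4" "0 < \<beta>" "\<beta> \<le> 1" "0 < \<gamma>" "\<kappa> \<le> 1" "4 * \<beta>\<^sup>2 \<le> \<gamma>\<^sup>2"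
    and R\<alpha>: "4 * real n * sqrt (real n) \<le> \<alpha> * R" and R\<beta>: "4 * real n \<le> \<beta> * R"
    and q: "q = real N * (w * R ^ n) / real (card G)"
    and z: "1 \<le> z" and v: "0 < v" "v \<le> 1"
    and less: "(16 * real n / \<alpha>) ^ n * (exp ((z - 1) * (q * exp (3 * \<alpha>))) / z powr m)
      + (16 * sqrt (real n) / \<beta>) ^ n * (exp (- (1 - v) * (q * (1 - 2 * \<kappa>))) / v powr k)
      + (16 * real n / \<alpha>) ^ n * (4 * \<beta>\<^sup>2 / \<gamma>\<^sup>2) powr k < 1"
  shows "\<exists>F\<subseteq>G. finite F \<and> card F \<le> N \<and>
    (\<forall>y. real (card {v \<in> zball n y R. phi v \<in> F}) \<le> m \<and> (\<exists>v\<in>zball n y R. phi v \<in> F))"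
proof -
  let ?s = "sqrt (real n)"
  have n0: "0 < real n" using n by simp
  have s0: "0 < ?s" using n by simp
  have w0: "0 < w" by simp
  \<comment> \<open>The rounding error sqrt n is at most a quarter of the fine net distance
    \<open>2 * dU\<close>.\<close>
  have s_le: "4 * ?s \<le> \<alpha> * R / real n" using R\<alpha> n0 by (simp add: field_simps)
  have aR: "\<alpha> * R / real n \<le> R / 8"
  proof -
    have "\<alpha> / real n \<le> (1 / 4) / 2" using par n by (intro frac_le) auto
    then have "\<alpha> / real n * R \<le> 1 / 4 / 2 * R" using R by (intro mult_right_mono) auto
    then show ?thesis by simp
  qed
  \<comment> \<open>Relative changes of the radius of order 1 / n alter the ball volume only by a
    constant factor, close to 1 for small parameters. Hence the spacing R / n of the fine net and
    the shape of \<open>rE\<close>.\<close>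
  define dU where "dU = \<alpha> * R / (2 * real n)"
  define dT where "dT = \<beta> * R / (2 * ?s)"
  \<comment> \<open>The net distance is \<open>2 * dU\<close>, and a further sqrt n accounts for
    rounding, as \<open>cover_from_net\<close> requires.\<close>
  define rD where "rD = R + 2 * dU + ?s"
  define rC where "rC = R - 2 * dU - ?s"
  define rE where "rE = R * (1 - \<kappa> / real n)"
  have dU2: "2 * dU = \<alpha> * R / real n" by (simp add: dU_def)
  have dT_ge: "2 * ?s \<le> dT"
  proof -
    have "2 * ?s * (2 * ?s) = 4 * real n" by simp
    also have "\<dots> \<le> \<beta> * R" by (rule R\<beta>)
    finally show ?thesis using s0 by (simp add: dT_def field_simps)
  qed
  have dT2: "2 * dT \<le> R"
  proof -
    have "1 \<le> ?s" using n by simp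
    have "\<beta> * R \<le> 1 * R" using par R by (intro mult_right_mono) auto
    also have "\<dots> \<le> ?s * R" using \<open>1 \<le> ?s\<close> R by (intro mult_right_mono) auto
    finally show ?thesis using s0 by (simp add: dT_def field_simps)
  qed
  obtain U where U: "U \<subseteq> zspace n" "finite U" "card U * card (zball n (\<lambda>_. 0) dU) \<le> card G"
    and netU: "\<And>x. x \<in> zspace n \<Longrightarrow> \<exists>u\<in>U. \<exists>x'\<in>zspace n. phi x' = phi x \<and> edist n (emb x') (emb u) \<le> 2 * dU"
    using ex_net[of dU] dU2 aR R s_le s0 by auto
  obtain T where T: "T \<subseteq> zspace n" "finite T" "card T * card (zball n (\<lambda>_. 0) dT) \<le> card G"
    and netT: "\<And>x. x \<in> zspace n \<Longrightarrow> \<exists>t\<in>T. \<exists>x'\<in>zspace n. phi x' = phi x \<and> edist n (emb x') (emb t) \<le> 2 * dT"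
    using ex_net[of dT] dT2 dT_ge R s0 by auto
  have cardU: "real (card U) \<le> (16 * real n / \<alpha>) ^ n"
    using card_net_le[of U dU "\<alpha> / (4 * real n)"] U(3) s_le n0 par dU2
    by (simp add: dU_def field_simps flip: of_nat_mult)
  have cardT: "real (card T) \<le> (16 * ?s / \<beta>) ^ n"
    using card_net_le[of T dT "\<beta> / (4 * ?s)"] T(3) dT_ge s0 par
    by (simp add: dT_def field_simps flip: of_nat_mult)
  define D where "D u = phi ` zball n (emb u) rD" for u
  define C where "C u = phi ` zball n (emb u) rC" for u
  define E where "E t = phi ` zball n (emb t) rE" for t
  have small: "2 * rD \<le> 3 * R" using dU2 aR s_le R by (simp add: rD_def)
  have \<kappa>0: "4 * \<alpha> \<le> \<kappa>" using par by (simp add: \<kappa>_def)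
  have \<kappa>n: "\<kappa> / real n \<le> 1 / 2" using par n0 n by (simp add: field_simps)
  have \<kappa>n2: "2 * \<kappa> / real n \<le> 1" using par n0 n by (simp add: field_simps)
  have rE_le: "rE \<le> R" using R \<kappa>0 par n0 by (simp add: rE_def field_simps)
  have rE_ge: "R / 2 \<le> rE" using R mult_left_mono[OF \<kappa>n, of R] unfolding rE_def right_diff_distrib by linarith
  have cardD: "real (card (D u)) \<le> w * R ^ n * exp (3 * \<alpha>)" for u
  proof -
    have "real (card (D u)) = real (card (zball n (\<lambda>_. 0) rD))"
      using small by (simp add: D_def card_phi_zball)
    also have "\<dots> \<le> w * (rD + ?s) ^ n"
      using n R dU2 aR s0 par by (intro card_zball_le) (auto simp: rD_def dU_def)
    also have "\<dots> \<le> w * (R * (1 + 3 * \<alpha> / real n)) ^ n"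
    proof (intro mult_left_mono power_mono)
      have "R * (1 + 3 * \<alpha> / real n) = R + 3 * (\<alpha> * R / real n)" by (simp add: algebra_simps)
      then show "rD + ?s \<le> R * (1 + 3 * \<alpha> / real n)" using s_le s0 dU2 unfolding rD_def by linarith
      show "0 \<le> rD + ?s" using R s_le s0 dU2 unfolding rD_def by linarith
    qed (use w0 in simp)
    also have "\<dots> = w * R ^ n * (1 + 3 * \<alpha> / real n) ^ n" by (simp add: power_mult_distrib)
    also have "\<dots> \<le> w * R ^ n * exp (3 * \<alpha> / real n) ^ n"
      using R par n0 by (intro mult_left_mono power_mono exp_ge_add_one_self) auto
    also have "exp (3 * \<alpha> / real n) ^ n = exp (3 * \<alpha>)" using n0 by (simp flip: exp_of_nat_mult)
    finally show ?thesis .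
  qed
  have cardE_eq: "card (E t) = card (zball n (\<lambda>_. 0) rE)" for t
    using rE_le R by (simp add: E_def card_phi_zball)
  have cardE: "w * R ^ n * (1 - 2 * \<kappa>) \<le> real (card (E t))" for t
  proof -
    have "w * R ^ n * (1 - 2 * \<kappa>) = w * R ^ n * (1 + real n * (- (2 * \<kappa> / real n)))" using n0 by simp
    also have "\<dots> \<le> w * R ^ n * (1 + - (2 * \<kappa> / real n)) ^ n"
      using R \<kappa>n2 by (intro mult_left_mono Bernoulli_inequality) auto
    also have "\<dots> = w * (R * (1 - 2 * \<kappa> / real n)) ^ n" by (simp add: power_mult_distrib)
    also have "\<dots> \<le> w * (rE - ?s) ^ n"
    proof (intro mult_left_mono power_mono)
      have "\<alpha> * R / real n \<le> \<kappa> * R / real n" using \<kappa>0 par R n0 by (intro divide_right_mono mult_right_mono) auto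
      moreover have "R * (1 - 2 * \<kappa> / real n) = R - 2 * (\<kappa> * R / real n)" "rE = R - \<kappa> * R / real n"
        by (simp_all add: rE_def algebra_simps)
      ultimately show "R * (1 - 2 * \<kappa> / real n) \<le> rE - ?s" using s_le s0 by linarith
      show "0 \<le> R * (1 - 2 * \<kappa> / real n)" using R \<kappa>n2 by (intro mult_nonneg_nonneg) linarith+
    qed (use w0 in simp)
    also have "\<dots> \<le> real (card (zball n (\<lambda>_. 0) rE))"
      using s_le aR rE_ge R s0 by (intro card_zball_ge) linarith
    finally show ?thesis by (simp add: cardE_eq)
  qed
  have sub: "phi ` zball n x r \<subseteq> G" for x r using latmap_in_residues[OF p] by blast
  have near: "\<exists>t\<in>T. real (card (E t - C u)) \<le> 4 * \<beta>\<^sup>2 / \<gamma>\<^sup>2 * real (card (E t))" if u: "u \<in> U" for u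
  proof -
    obtain t x where t: "t \<in> T" "x \<in> zspace n" "phi x = phi u" "edist n (emb x) (emb t) \<le> 2 * dT"
      using netT[of u] u U(1) by blast
    have eq: "R * (1 - 2 * \<alpha> / real n) = R - 2 * (\<alpha> * R / real n)" by (simp add: algebra_simps)
    have rC: "R * (1 - 2 * \<alpha> / real n) \<le> rC"
      using s_le s0 dU2 unfolding rC_def eq by linarith
    have pos: "0 \<le> R * (1 - 2 * \<alpha> / real n)" using R aR unfolding eq by linarith
    have sq: "(1 - x)\<^sup>2 \<le> 1 - x" if "0 \<le> x" "x \<le> 1" for x :: real
      using that mult_left_mono[of x 1 x] by (simp add: power2_eq_square algebra_simps)
    \<comment> \<open>The budget behind \<open>\<kappa>\<close>: \<open>4 * \<alpha>\<close> is the
      loss in \<open>rC\<close>, \<open>\<gamma>\<close> the Chebyshev threshold and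
      \<open>\<beta>\<^sup>2\<close> the squared coarse distance, all in units of
      \<open>R\<^sup>2 / n\<close>. A coarse distance of order R / sqrt n is affordable because it
      enters squared.\<close>
    have le: "rE\<^sup>2 + \<gamma> * R\<^sup>2 / real n + (2 * dT)\<^sup>2 \<le> rC\<^sup>2"
    proof -
      have "rE\<^sup>2 = R\<^sup>2 * (1 - \<kappa> / real n)\<^sup>2" by (simp add: rE_def power_mult_distrib)
      also have "\<dots> \<le> R\<^sup>2 * (1 - \<kappa> / real n)"
      proof (intro mult_left_mono sq)
        show "0 \<le> \<kappa> / real n" using \<kappa>0 par by simp
        show "\<kappa> / real n \<le> 1" using \<kappa>n by linarith
      qed simp
      finally have 1: "rE\<^sup>2 \<le> R\<^sup>2 * (1 - \<kappa> / real n)" .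
      have 2: "(2 * dT)\<^sup>2 = R\<^sup>2 * (\<beta>\<^sup>2 / real n)"
        using n0 by (simp add: dT_def power_mult_distrib power_divide)
      have "R\<^sup>2 * (1 - 4 * \<alpha> / real n) \<le> R\<^sup>2 * (1 - 2 * \<alpha> / real n)\<^sup>2"
        by (intro mult_left_mono) (auto simp: power2_diff)
      also have "\<dots> = (R * (1 - 2 * \<alpha> / real n))\<^sup>2" by (simp add: power_mult_distrib)
      also have "\<dots> \<le> rC\<^sup>2" using rC pos by (intro power_mono)
      finally have 3: "R\<^sup>2 * (1 - 4 * \<alpha> / real n) \<le> rC\<^sup>2" .
      have "R\<^sup>2 * (1 - \<kappa> / real n) + \<gamma> * R\<^sup>2 / real n + R\<^sup>2 * (\<beta>\<^sup>2 / real n) = R\<^sup>2 * (1 - 4 * \<alpha> / real n)"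
        using n0 by (simp add: \<kappa>_def field_simps)
      with 1 2 3 show ?thesis by linarith
    qed
    let ?c = "real (card (zball n (emb t) rE - zball n (emb x) rC))"
    let ?L = "real (card (zball n (\<lambda>_. 0) rE))"
    \<comment> \<open>With threshold \<open>\<gamma> * R\<^sup>2 / n\<close> and squared distance
      \<open>\<beta>\<^sup>2 * R\<^sup>2 / n\<close> the dimension cancels, leaving the proportion
      \<open>4 * \<beta>\<^sup>2 / \<gamma>\<^sup>2\<close>.\<close>
    have "real n * (\<gamma> * R\<^sup>2 / real n)\<^sup>2 * ?c \<le> 4 * (2 * dT)\<^sup>2 * rE\<^sup>2 * ?L"
    proof (rule card_zball_diff_le)
      show "0 \<le> rE" "0 \<le> rC" using rE_ge R rC pos by linarith+
      show "0 < \<gamma> * R\<^sup>2 / real n" using par R n0 by simp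
    qed (fact t(4) le)+
    also have "\<dots> \<le> 4 * (2 * dT)\<^sup>2 * R\<^sup>2 * ?L"
      using rE_le rE_ge R by (intro mult_right_mono mult_left_mono power_mono) auto
    finally have "(R\<^sup>2 * R\<^sup>2 / real n) * (\<gamma>\<^sup>2 * ?c) \<le> (R\<^sup>2 * R\<^sup>2 / real n) * (4 * \<beta>\<^sup>2 * ?L)"
      using n0 by (simp add: dT_def power_mult_distrib power_divide power2_eq_square mult_ac)
    then have "\<gamma>\<^sup>2 * ?c \<le> 4 * \<beta>\<^sup>2 * ?L" by (rule mult_left_le_imp_le) (use R n0 in simp)
    then have "?c \<le> 4 * \<beta>\<^sup>2 / \<gamma>\<^sup>2 * ?L" using par by (simp add: field_simps)
    moreover have "card (E t - C u) \<le> card (zball n (emb t) rE - zball n (emb x) rC)"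
    proof -
      \<comment> \<open>Seen in the torus, the ball around \<open>u\<close> is also the ball around
        the representative \<open>x\<close> near \<open>t\<close>.\<close>
      have C_eq: "C u = phi ` zball n (emb x) rC"
        unfolding C_def by (rule phi_image_zball_eq[OF t(3)[symmetric]])
      have "E t - C u \<subseteq> phi ` (zball n (emb t) rE - zball n (emb x) rC)"
        unfolding E_def C_eq by (rule image_diff_subset)
      then have "card (E t - C u) \<le> card (phi ` (zball n (emb t) rE - zball n (emb x) rC))"
        by (rule card_mono[rotated]) (simp add: finite_zball)
      also have "\<dots> \<le> card (zball n (emb t) rE - zball n (emb x) rC)"
        by (rule card_image_le) (simp add: finite_zball)
      finally show ?thesis .
    qed
    ultimately have "real (card (E t - C u)) \<le> 4 * \<beta>\<^sup>2 / \<gamma>\<^sup>2 * ?L" by linarith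
    then show ?thesis using t(1) by (auto simp: cardE_eq)
  qed
  then obtain \<tau> where \<tau>: "\<And>u. u \<in> U \<Longrightarrow> \<tau> u \<in> T \<and> real (card (E (\<tau> u) - C u)) \<le> 4 * \<beta>\<^sup>2 / \<gamma>\<^sup>2 * real (card (E (\<tau> u)))"
    by metis
  have e1: "(z - 1) * real N * (w * R ^ n * exp (3 * \<alpha>)) / real (card G) = (z - 1) * (q * exp (3 * \<alpha>))"
    and e2: "- (1 - v) * real N * (w * R ^ n * (1 - 2 * \<kappa>)) / real (card G) = - (1 - v) * (q * (1 - 2 * \<kappa>))"
    by (simp_all add: q)
  have \<eta>: "0 < 4 * \<beta>\<^sup>2 / \<gamma>\<^sup>2" "4 * \<beta>\<^sup>2 / \<gamma>\<^sup>2 \<le> 1" using par by (auto simp: field_simps)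
  have "real (card U) * (exp ((z - 1) * (q * exp (3 * \<alpha>))) / z powr m)
      + real (card T) * (exp (- (1 - v) * (q * (1 - 2 * \<kappa>))) / v powr k)
      + real (card U) * (4 * \<beta>\<^sup>2 / \<gamma>\<^sup>2) powr k
    \<le> (16 * real n / \<alpha>) ^ n * (exp ((z - 1) * (q * exp (3 * \<alpha>))) / z powr m)
      + (16 * ?s / \<beta>) ^ n * (exp (- (1 - v) * (q * (1 - 2 * \<kappa>))) / v powr k)
      + (16 * real n / \<alpha>) ^ n * (4 * \<beta>\<^sup>2 / \<gamma>\<^sup>2) powr k"
    by (intro add_mono mult_right_mono cardU cardT) auto
  then have less': "real (card U) * (exp ((z - 1) * real N * (w * R ^ n * exp (3 * \<alpha>)) / real (card G)) / z powr m)
      + real (card T) * (exp (- (1 - v) * real N * (w * R ^ n * (1 - 2 * \<kappa>)) / real (card G)) / v powr k)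
      + real (card U) * (4 * \<beta>\<^sup>2 / \<gamma>\<^sup>2) powr k < 1"
    unfolding e1 e2 using less by linarith
  have "\<exists>f\<in>PiE {..<N} (\<lambda>_. G). \<forall>u\<in>U.
      real (card {i \<in> {..<N}. f i \<in> D u}) \<le> m \<and> (\<exists>i<N. f i \<in> C u)"
  proof (rule random_choice_exists)
    show "D u \<subseteq> G \<and> real (card (D u)) \<le> w * R ^ n * exp (3 * \<alpha>)" for u
      using cardD sub unfolding D_def by blast
    show "E t \<subseteq> G \<and> w * R ^ n * (1 - 2 * \<kappa>) \<le> real (card (E t))" for t
      using cardE sub unfolding E_def by blast
    show "\<tau> u \<in> T \<and> real (card (E (\<tau> u) - C u)) \<le> 4 * \<beta>\<^sup>2 / \<gamma>\<^sup>2 * real (card (E (\<tau> u)))"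
      if "u \<in> U" for u by (rule \<tau>[OF that])
  qed (fact finite_residues G_nonempty U(2) T(2) z v \<eta> less')+
  then obtain f where f: "f \<in> PiE {..<N} (\<lambda>_. G)"
    "\<And>u. u \<in> U \<Longrightarrow> real (card {i \<in> {..<N}. f i \<in> D u}) \<le> m \<and> (\<exists>i<N. f i \<in> C u)"
    by blast
  show ?thesis
  proof (intro exI[of _ "f ` {..<N}"] conjI allI)
    show "f ` {..<N} \<subseteq> G" using f(1) by auto
    show "card (f ` {..<N}) \<le> N" using card_image_le[of "{..<N}" f] by simp
    fix y
    have "real (card {v \<in> zball n y R. phi v \<in> f ` {..<N}}) \<le> m \<and>
        (\<exists>v\<in>zball n y R. phi v \<in> f ` {..<N})"
    proof (intro conjI cover_from_net[where U = U and d = "2 * dU" and f = f and N = N])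
      show "\<exists>u\<in>U. \<exists>x'\<in>zspace n. phi x' = phi x \<and> edist n (emb x') (emb u) \<le> 2 * dU"
        if "x \<in> zspace n" for x by (rule netU[OF that])
      show "\<exists>u\<in>U. \<exists>x'\<in>zspace n. phi x' = phi x \<and> edist n (emb x') (emb u) \<le> 2 * dU"
        if "x \<in> zspace n" for x by (rule netU[OF that])
    qed (use small f(2) in \<open>auto simp: rD_def rC_def D_def C_def\<close>)
    then show "real (card {v \<in> zball n y R. phi v \<in> f ` {..<N}}) \<le> m"
      and "\<exists>v\<in>zball n y R. phi v \<in> f ` {..<N}" by blast+
  qed simp
qed

end

section \<open>Periodic coverings of space\<close>

text \<open>Division by \<open>R\<close> turns integer balls of radius \<open>R\<close> into
  statements about unit balls.\<close>

definition zscale :: "nat \<Rightarrow> real \<Rightarrow> (nat \<Rightarrow> int) \<Rightarrow> nat \<Rightarrow> real" where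
  "zscale n R v = (\<lambda>i\<in>{..<n}. real_of_int (v i) / R)"

lemma zscale_in [simp]: "zscale n R v \<in> rspace n"
  by (simp add: zscale_def)

lemma zscale_apply [simp]: "i < n \<Longrightarrow> zscale n R v i = real_of_int (v i) / R"
  by (simp add: zscale_def)

lemma edist_zscale:
  assumes "0 < R"
  shows "R * edist n (zscale n R v) x = edist n (emb v) (\<lambda>i. R * x i)"
proof -
  have "R * edist n (zscale n R v) x = L2_set (\<lambda>i. R * (zscale n R v i - x i)) {..<n}"
    using assms by (simp add: edist_def L2_set_right_distrib)
  also have "\<dots> = edist n (emb v) (\<lambda>i. R * x i)"
    unfolding edist_def using assms by (intro L2_set_cong) (auto simp: field_simps)
  finally show ?thesis .
qed

lemma mem_eball_zscale_iff:
  assumes "0 < R" "v \<in> zspace n" "x \<in> rspace n"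
  shows "x \<in> eball n 1 (zscale n R v) \<longleftrightarrow> v \<in> zball n (\<lambda>i. R * x i) R"
proof -
  have "edist n (zscale n R v) x \<le> 1 \<longleftrightarrow> R * edist n (zscale n R v) x \<le> R"
    using assms(1) by simp
  also have "\<dots> \<longleftrightarrow> edist n (emb v) (\<lambda>i. R * x i) \<le> R" by (simp only: edist_zscale[OF assms(1)])
  finally show ?thesis using assms(2,3) by (simp only: eball_def zball_def mem_Collect_eq simp_thms)
qed

lemma inj_on_zscale:
  assumes "0 < R"
  shows "inj_on (zscale n R) (zspace n)"
proof (rule inj_onI)
  fix v w assume vw: "v \<in> zspace n" "w \<in> zspace n" "zscale n R v = zscale n R w"
  show "v = w"
  proof (rule PiE_ext[OF vw(1,2)])
    fix i assume "i \<in> {..<n}"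
    then have "real_of_int (v i) / R = real_of_int (w i) / R"
      using zscale_apply[of i n R] vw(3) by (metis lessThan_iff)
    then show "v i = w i" using assms by simp
  qed
qed

text \<open>Distinct points differ by at least \<open>1 / R\<close> in some coordinate, so an open
  box of this half-width isolates each of them.\<close>

lemma discrete_in_zscale_image:
  assumes R: "0 < R" and V: "V \<subseteq> zspace n"
  shows "discrete_in n (zscale n R ` V)"
proof -
  let ?X = "product_topology (\<lambda>_. euclideanreal) {..<n}"
  have "openin (subtopology ?X (zscale n R ` V)) {zscale n R v}" if v: "v \<in> V" for v
  proof -
    define B where "B = PiE {..<n} (\<lambda>i. {zscale n R v i - 1 / R<..<zscale n R v i + 1 / R})"
    have "openin ?X B" unfolding B_def by (subst openin_PiE_gen) auto
    moreover have "{zscale n R v} = B \<inter> zscale n R ` V"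
    proof
      have "zscale n R v \<in> B"
        unfolding B_def using R zscale_in[of n R v] by (auto simp: PiE_iff)
      with v show "{zscale n R v} \<subseteq> B \<inter> zscale n R ` V" by blast
      show "B \<inter> zscale n R ` V \<subseteq> {zscale n R v}"
      proof
        fix y assume "y \<in> B \<inter> zscale n R ` V"
        then obtain u where u: "u \<in> V" "y = zscale n R u" "y \<in> B" by blast
        have "u = v"
        proof (rule PiE_ext)
          show "u \<in> zspace n" "v \<in> zspace n" using u v V by blast+
          fix i assume i: "i \<in> {..<n}"
          with u(3) have "y i \<in> {zscale n R v i - 1 / R<..<zscale n R v i + 1 / R}"
            unfolding B_def by (rule PiE_mem)
          with i u(2) have "(real_of_int (v i) - 1) / R < real_of_int (u i) / R"
            "real_of_int (u i) / R < (real_of_int (v i) + 1) / R"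
            by (auto simp: diff_divide_distrib add_divide_distrib)
          then have "real_of_int (v i) - 1 < real_of_int (u i)" "real_of_int (u i) < real_of_int (v i) + 1"
            using R by (simp_all add: divide_less_cancel)
          then show "u i = v i" by linarith
        qed
        with u show "y \<in> {zscale n R v}" by simp
      qed
    qed
    ultimately show ?thesis by (auto simp: openin_subtopology)
  qed
  moreover have "topspace (subtopology ?X (zscale n R ` V)) = zscale n R ` V"
  proof -
    have "zscale n R ` V \<subseteq> rspace n" using zscale_in by blast
    then show ?thesis by (simp add: Int_absorb1)
  qed
  ultimately show ?thesis
    unfolding discrete_in_def by (intro sym[OF discrete_topology_unique[THEN iffD2]]) auto
qed

section \<open>Counting centres in a cube and the density\<close>

lemma card_int_between_le:
  fixes x y :: real
  assumes "x \<le> y"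
  shows "finite {s :: int. x \<le> real_of_int s \<and> real_of_int s \<le> y}"
    and "real (card {s :: int. x \<le> real_of_int s \<and> real_of_int s \<le> y}) \<le> y - x + 1"
proof -
  have eq: "{s :: int. x \<le> real_of_int s \<and> real_of_int s \<le> y} = {\<lceil>x\<rceil>..\<lfloor>y\<rfloor>}"
    by (auto simp: ceiling_le_iff le_floor_iff)
  show "finite {s :: int. x \<le> real_of_int s \<and> real_of_int s \<le> y}" unfolding eq by simp
  show "real (card {s :: int. x \<le> real_of_int s \<and> real_of_int s \<le> y}) \<le> y - x + 1"
    unfolding eq using assms by simp linarith
qed

text \<open>Division by \<open>p\<close> is injective on a residue class and maps it into an
  interval of length \<open>2 * K / p\<close>.\<close>

lemma card_residue_class_le:
  fixes K :: real and p :: int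
  assumes p: "0 < p" and K: "0 \<le> K"
  shows "finite {t :: int. \<bar>real_of_int t\<bar> \<le> K \<and> (t - b) mod p = c}"
    and "real (card {t :: int. \<bar>real_of_int t\<bar> \<le> K \<and> (t - b) mod p = c}) \<le> 2 * K / real_of_int p + 1"
proof -
  let ?A = "{t :: int. \<bar>real_of_int t\<bar> \<le> K \<and> (t - b) mod p = c}"
  let ?x = "(- K - b - c) / real_of_int p" and ?y = "(K - b - c) / real_of_int p"
  let ?B = "{s :: int. ?x \<le> real_of_int s \<and> real_of_int s \<le> ?y}"
  have t: "t = p * ((t - b) div p) + b + c" if "t \<in> ?A" for t
    using that by (auto simp: minus_mod_eq_mult_div[symmetric])
  have inj: "inj_on (\<lambda>t. (t - b) div p) ?A"
  proof (rule inj_onI)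
    fix s u assume s: "s \<in> ?A" and u: "u \<in> ?A" and eq: "(s - b) div p = (u - b) div p"
    have "s = p * ((s - b) div p) + b + c" by (rule t[OF s])
    also have "\<dots> = p * ((u - b) div p) + b + c" unfolding eq ..
    also have "\<dots> = u" by (rule t[OF u, symmetric])
    finally show "s = u" .
  qed
  have img: "(\<lambda>t. (t - b) div p) ` ?A \<subseteq> ?B"
  proof
    fix s assume "s \<in> (\<lambda>t. (t - b) div p) ` ?A"
    then obtain u where u: "u \<in> ?A" "s = (u - b) div p" by blast
    have "u = p * s + b + c" using t[OF u(1)] u(2) by simp
    then have "real_of_int u = real_of_int p * real_of_int s + b + c" by simp
    with u(1) p show "s \<in> ?B" by (auto simp: field_simps abs_le_iff)
  qed
  have xy: "?x \<le> ?y" using p K by (intro divide_right_mono) auto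
  show fin: "finite ?A"
    using finite_subset[OF img card_int_between_le(1)[OF xy]] inj by (rule finite_imageD)
  have "card ?A \<le> card ?B"
    by (rule card_inj_on_le[OF inj img card_int_between_le(1)[OF xy]])
  then have "real (card ?A) \<le> ?y - ?x + 1" using card_int_between_le(2)[OF xy] by linarith
  also have "?y - ?x = 2 * K / real_of_int p" by (simp add: field_simps diff_divide_distrib[symmetric])
  finally show "real (card ?A) \<le> 2 * K / real_of_int p + 1" .
qed

text \<open>A class \<open>c\<close> in \<open>F\<close> and the first coordinate \<open>s\<close>
  are chosen freely; every other coordinate is then confined to one residue class modulo
  \<open>p\<close>.\<close>

lemma card_periodic_box_le:
  fixes K :: real and p :: int and a :: "nat \<Rightarrow> int"
  assumes n: "0 < n" and p: "0 < p" and K: "0 \<le> K" and F: "finite F"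
  defines "S \<equiv> {v \<in> zspace n. latmap p a n v \<in> F \<and> (\<forall>i<n. \<bar>real_of_int (v i)\<bar> \<le> K)}"
  shows "finite S" and "real (card S) \<le> real (card F) * (2 * K + 1) * (2 * K / real_of_int p + 1) ^ (n - 1)"
proof -
  let ?I = "{s :: int. - K \<le> real_of_int s \<and> real_of_int s \<le> K}"
  define B where "B c s i = (if i = 0 then {s} else {t :: int. \<bar>real_of_int t\<bar> \<le> K \<and> (t - a i * s) mod p = c i})"
    for c :: "nat \<Rightarrow> int" and s and i :: nat
  have I: "finite ?I" "real (card ?I) \<le> 2 * K + 1"
    using card_int_between_le[of "- K" K] K by auto
  have finB: "finite (PiE {..<n} (B c s))" for c s
    using card_residue_class_le(1)[OF p K] by (intro finite_PiE) (auto simp: B_def)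
  have cardB: "real (card (PiE {..<n} (B c s))) \<le> (2 * K / real_of_int p + 1) ^ (n - 1)" for c s
  proof -
    have "{..<n} = insert 0 {1..<n}" using n by auto
    then have "real (card (PiE {..<n} (B c s))) = (\<Prod>i\<in>insert 0 {1..<n}. real (card (B c s i)))"
      by (simp add: card_PiE)
    also have "\<dots> = (\<Prod>i\<in>{1..<n}. real (card (B c s i)))"
      by (simp add: B_def)
    also have "\<dots> \<le> (\<Prod>i\<in>{1..<n}. 2 * K / real_of_int p + 1)"
      using card_residue_class_le(2)[OF p K] by (intro prod_mono) (auto simp: B_def)
    finally show ?thesis by simp
  qed
  have sub: "S \<subseteq> (\<Union>c\<in>F. \<Union>s\<in>?I. PiE {..<n} (B c s))"
  proof
    fix v assume v: "v \<in> S"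
    have "v \<in> PiE {..<n} (B (latmap p a n v) (v 0))"
      using v by (auto simp: S_def B_def PiE_iff latmap_def)
    moreover have "v 0 \<in> ?I" "latmap p a n v \<in> F" using v n by (auto simp: S_def abs_le_iff)
    ultimately show "v \<in> (\<Union>c\<in>F. \<Union>s\<in>?I. PiE {..<n} (B c s))" by blast
  qed
  show "finite S" by (rule finite_subset[OF sub]) (use F I finB in blast)
  have "card S \<le> card (\<Union>c\<in>F. \<Union>s\<in>?I. PiE {..<n} (B c s))"
    by (rule card_mono[OF _ sub]) (use F I finB in blast)
  also have "\<dots> \<le> (\<Sum>c\<in>F. card (\<Union>s\<in>?I. PiE {..<n} (B c s)))" by (rule card_UN_le[OF F])
  also have "\<dots> \<le> (\<Sum>c\<in>F. \<Sum>s\<in>?I. card (PiE {..<n} (B c s)))"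
    by (intro sum_mono card_UN_le I)
  finally have "real (card S) \<le> real (\<Sum>c\<in>F. \<Sum>s\<in>?I. card (PiE {..<n} (B c s)))" by (rule of_nat_mono)
  also have "\<dots> = (\<Sum>c\<in>F. \<Sum>s\<in>?I. real (card (PiE {..<n} (B c s))))" by simp
  also have "\<dots> \<le> (\<Sum>c\<in>F. \<Sum>s\<in>?I. (2 * K / real_of_int p + 1) ^ (n - 1))"
    by (intro sum_mono cardB)
  also have "\<dots> = real (card F) * real (card ?I) * (2 * K / real_of_int p + 1) ^ (n - 1)" by simp
  also have "\<dots> \<le> real (card F) * (2 * K + 1) * (2 * K / real_of_int p + 1) ^ (n - 1)"
    using I(2) K p by (intro mult_right_mono mult_left_mono) auto
  finally show "real (card S) \<le> real (card F) * (2 * K + 1) * (2 * K / real_of_int p + 1) ^ (n - 1)" .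
qed

lemma vol_cube: "0 \<le> r \<Longrightarrow> vol n (cube n r) = ennreal ((2 * r) ^ n)"
  unfolding cube_def by (subst vol_box) auto

text \<open>Only centres in the cube of half-side \<open>r + 1\<close> have balls meeting the cube.
  Counting each of them with its full ball volume loses only a boundary effect, which vanishes in
  the limit.\<close>

lemma density_on_periodic_le:
  fixes R r :: real and p :: int
  assumes n: "0 < n" and p: "0 < p" and R: "0 < R" and F: "finite F" and r: "0 < r"
  shows "density_on n (zscale n R ` {v \<in> zspace n. latmap p a n v \<in> F}) (cube n r)
    \<le> ennreal (real (card F) * (2 * (R * (r + 1)) + 1) * (2 * (R * (r + 1)) / real_of_int p + 1) ^ (n - 1)
        * unit_ball_vol (real n) / (2 * r) ^ n)"
proof -
  let ?K = "R * (r + 1)"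
  let ?V = "{v \<in> zspace n. latmap p a n v \<in> F}"
  let ?w = "unit_ball_vol (real n)"
  define S where "S = {v \<in> zspace n. latmap p a n v \<in> F \<and> (\<forall>i<n. \<bar>real_of_int (v i)\<bar> \<le> ?K)}"
  have K: "0 \<le> ?K" using R r by simp
  note S = card_periodic_box_le[OF n p K F, of a, folded S_def]
  have zero: "vol n (cube n r \<inter> eball n 1 (zscale n R v)) = 0" if v: "v \<in> ?V" "v \<notin> S" for v
  proof -
    obtain i where i: "i < n" "?K < \<bar>real_of_int (v i)\<bar>" using v by (auto simp: S_def not_le)
    have "cube n r \<inter> eball n 1 (zscale n R v) = {}"
    proof (rule ccontr)
      assume "cube n r \<inter> eball n 1 (zscale n R v) \<noteq> {}"
      then obtain y where y: "y \<in> cube n r" "y \<in> eball n 1 (zscale n R v)" by blast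
      have "y i \<in> {- r..r}" using PiE_mem[OF y(1)[unfolded cube_def], of i] i(1) by simp
      moreover have "\<bar>zscale n R v i - y i\<bar> \<le> 1"
        using abs_diff_le_edist[OF i(1), of "zscale n R v" y] y(2) unfolding eball_def by simp
      ultimately have "\<bar>real_of_int (v i) / R\<bar> \<le> r + 1" using i(1) by (auto simp: abs_le_iff)
      then have "\<bar>real_of_int (v i)\<bar> \<le> ?K" using R by (simp add: abs_divide field_simps)
      with i(2) show False by simp
    qed
    then show ?thesis by (simp add: vol_def)
  qed
  have "(\<Sum>\<^sub>\<infinity>q\<in>zscale n R ` ?V. vol n (cube n r \<inter> eball n 1 q))
      = (\<Sum>\<^sub>\<infinity>q\<in>zscale n R ` S. vol n (cube n r \<inter> eball n 1 q))"
  proof (rule infsum_cong_neutral)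
    fix q assume "q \<in> zscale n R ` S - zscale n R ` ?V"
    then show "vol n (cube n r \<inter> eball n 1 q) = 0" unfolding S_def by blast
  next
    fix q assume q: "q \<in> zscale n R ` ?V - zscale n R ` S"
    then obtain v where v: "v \<in> ?V" "q = zscale n R v" by blast
    with q have "v \<notin> S" by blast
    from zero[OF v(1) this] v(2) show "vol n (cube n r \<inter> eball n 1 q) = 0" by (simp only:)
  qed simp
  also have "\<dots> = (\<Sum>q\<in>zscale n R ` S. vol n (cube n r \<inter> eball n 1 q))"
    using S(1) by simp
  also have "\<dots> \<le> (\<Sum>q\<in>zscale n R ` S. ennreal ?w)"
  proof (rule sum_mono)
    fix q
    have "vol n (cube n r \<inter> eball n 1 q) \<le> vol n (eball n 1 q)"
      unfolding vol_def by (intro emeasure_mono eball_in_sets) auto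
    then show "vol n (cube n r \<inter> eball n 1 q) \<le> ennreal ?w" by (simp add: vol_eball)
  qed
  also have "\<dots> = of_nat (card (zscale n R ` S)) * ennreal ?w" by simp
  also have "card (zscale n R ` S) = card S"
    by (rule card_image, rule inj_on_subset[OF inj_on_zscale[OF R]]) (auto simp: S_def)
  also have "of_nat (card S) * ennreal ?w = ennreal (real (card S) * ?w)"
    by (simp add: ennreal_of_nat_eq_real_of_nat ennreal_mult')
  also have "\<dots> \<le> ennreal (real (card F) * (2 * ?K + 1) * (2 * ?K / real_of_int p + 1) ^ (n - 1) * ?w)"
    by (intro ennreal_leI mult_right_mono S(2)) simp
  finally have "density_on n (zscale n R ` ?V) (cube n r)
      \<le> ennreal (real (card F) * (2 * ?K + 1) * (2 * ?K / real_of_int p + 1) ^ (n - 1) * ?w) / vol n (cube n r)"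
    unfolding density_on_def by (rule divide_right_mono_ennreal)
  also have "\<dots> = ennreal (real (card F) * (2 * ?K + 1) * (2 * ?K / real_of_int p + 1) ^ (n - 1) * ?w / (2 * r) ^ n)"
    using r K p by (subst vol_cube) (auto intro!: divide_ennreal mult_nonneg_nonneg)
  finally show ?thesis .
qed

lemma covering_density_periodic_le:
  fixes R :: real and p :: int
  assumes n: "0 < n" and p: "0 < p" and R: "0 < R" and F: "finite F"
  shows "covering_density n (zscale n R ` {v \<in> zspace n. latmap p a n v \<in> F})
    \<le> ennreal (real (card F) * (unit_ball_vol (real n) * R ^ n) / real_of_int p ^ (n - 1))"
proof -
  let ?w = "unit_ball_vol (real n)"
  let ?g = "\<lambda>r. real (card F) * (2 * (R * (r + 1)) + 1) * (2 * (R * (r + 1)) / real_of_int p + 1) ^ (n - 1) * ?w / (2 * r) ^ n"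
  \<comment> \<open>This is \<open>?g\<close> with the power of \<open>2 * r\<close> distributed
    over its factors, so that the limit can be taken factor by factor.\<close>
  let ?h = "\<lambda>r. real (card F) * ?w * (R + (2 * R + 1) / 2 * inverse r)
      * (R / real_of_int p + (2 * R / real_of_int p + 1) / 2 * inverse r) ^ (n - 1)"
  have inv: "(inverse \<longlongrightarrow> (0 :: real)) at_top" by (rule tendsto_inverse_0_at_top[OF filterlim_ident])
  have lin: "((\<lambda>r. c + d * inverse r) \<longlongrightarrow> c + d * 0) at_top" for c d :: real
    by (intro tendsto_add tendsto_const tendsto_mult inv)
  have "(?h \<longlongrightarrow> real (card F) * ?w * (R + (2 * R + 1) / 2 * 0)
      * (R / real_of_int p + (2 * R / real_of_int p + 1) / 2 * 0) ^ (n - 1)) at_top"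
    by (rule tendsto_mult[OF tendsto_mult[OF tendsto_const lin] tendsto_power[OF lin]])
  also have "real (card F) * ?w * (R + (2 * R + 1) / 2 * 0)
      * (R / real_of_int p + (2 * R / real_of_int p + 1) / 2 * 0) ^ (n - 1)
      = real (card F) * (?w * R ^ n) / real_of_int p ^ (n - 1)"
    using n by (cases n) (simp_all add: power_divide)
  finally have h: "(?h \<longlongrightarrow> real (card F) * (?w * R ^ n) / real_of_int p ^ (n - 1)) at_top" .
  have gh: "?g r = ?h r" if r: "0 < r" for r
  proof -
    have "(2 * r) ^ n = (2 * r) * (2 * r) ^ (n - 1)" using n by (cases n) simp_all
    then have "?g r = real (card F) * ?w * ((2 * (R * (r + 1)) + 1) / (2 * r))
        * ((2 * (R * (r + 1)) / real_of_int p + 1) / (2 * r)) ^ (n - 1)"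
      by (simp add: power_divide)
    also have "(2 * (R * (r + 1)) + 1) / (2 * r) = R + (2 * R + 1) / 2 * inverse r"
      using r by (simp add: field_simps)
    also have "(2 * (R * (r + 1)) / real_of_int p + 1) / (2 * r) = R / real_of_int p + (2 * R / real_of_int p + 1) / 2 * inverse r"
      using r p by (simp add: field_simps)
    finally show ?thesis .
  qed
  have "covering_density n (zscale n R ` {v \<in> zspace n. latmap p a n v \<in> F}) \<le> Limsup at_top (\<lambda>r. ennreal (?h r))"
    unfolding covering_density_def
  proof (rule Limsup_mono)
    show "\<forall>\<^sub>F r in at_top. density_on n (zscale n R ` {v \<in> zspace n. latmap p a n v \<in> F}) (cube n r) \<le> ennreal (?h r)"
      using eventually_gt_at_top[of 0]
    proof eventually_elim
      case (elim r)
      show ?case using density_on_periodic_le[OF n p R F elim, of a] unfolding gh[OF elim] .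
    qed
  qed
  also have "\<dots> = ennreal (real (card F) * (?w * R ^ n) / real_of_int p ^ (n - 1))"
    by (intro lim_imp_Limsup tendsto_ennrealI h) simp
  finally show ?thesis .
qed

text \<open>A point \<open>x\<close> lies in the unit ball around a scaled \<open>v\<close> exactly
  when \<open>v\<close> lies in the integer ball of radius \<open>R\<close> around
  \<open>R * x\<close>. Both hypotheses are therefore applied at that centre.\<close>

lemma periodic_covering:
  fixes R M :: real and p :: int
  assumes n: "0 < n" and p: "0 < p" and R: "0 < R" and F: "finite F"
    and mult: "\<And>y. real (card {v \<in> zball n y R. latmap p a n v \<in> F}) \<le> M"
    and cover: "\<And>y. \<exists>v\<in>zball n y R. latmap p a n v \<in> F"
  shows "\<exists>P. unit_ball_covering n P \<and>
    covering_density n P \<le> ennreal (real (card F) * (unit_ball_vol (real n) * R ^ n) / real_of_int p ^ (n - 1)) \<and>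
    covering_multiplicity n P \<le> ennreal M"
proof (intro exI conjI)
  let ?V = "{v \<in> zspace n. latmap p a n v \<in> F}"
  let ?P = "zscale n R ` ?V"
  show "unit_ball_covering n ?P"
    unfolding unit_ball_covering_def
  proof (intro conjI)
    show "?P \<subseteq> rspace n" using zscale_in by blast
    show "discrete_in n ?P" by (rule discrete_in_zscale_image[OF R]) auto
    show "rspace n \<subseteq> (\<Union>q\<in>?P. eball n 1 q)"
    proof
      fix x assume x: "x \<in> rspace n"
      obtain v where v: "v \<in> zball n (\<lambda>i. R * x i) R" "latmap p a n v \<in> F" using cover by blast
      then have "v \<in> zspace n" using zball_subset by blast
      then show "x \<in> (\<Union>q\<in>?P. eball n 1 q)" using v mem_eball_zscale_iff[OF R _ x] by blast
    qed
  qed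
  show "covering_density n ?P \<le> ennreal (real (card F) * (unit_ball_vol (real n) * R ^ n) / real_of_int p ^ (n - 1))"
    by (rule covering_density_periodic_le[OF n p R F])
  show "covering_multiplicity n ?P \<le> ennreal M"
    unfolding covering_multiplicity_def
  proof (rule SUP_least)
    fix x assume x: "x \<in> rspace n"
    let ?B = "{v \<in> zball n (\<lambda>i. R * x i) R. latmap p a n v \<in> F}"
    have finB: "finite ?B" using finite_zball by simp
    have sub: "{q \<in> ?P. x \<in> eball n 1 q} \<subseteq> zscale n R ` ?B"
      using mem_eball_zscale_iff[OF R _ x] by blast
    have "multiplicity_at n ?P x = ennreal (real (card {q \<in> ?P. x \<in> eball n 1 q}))"
      unfolding multiplicity_at_def using finite_subset[OF sub finite_imageI[OF finB]]
      by (simp add: emeasure_count_space ennreal_of_nat_eq_real_of_nat)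
    also have "\<dots> \<le> ennreal M"
    proof (rule ennreal_leI)
      have "card {q \<in> ?P. x \<in> eball n 1 q} \<le> card (zscale n R ` ?B)"
        using sub finB by (intro card_mono) auto
      also have "\<dots> \<le> card ?B" by (rule card_image_le[OF finB])
      finally show "real (card {q \<in> ?P. x \<in> eball n 1 q}) \<le> M" using mult[of "\<lambda>i. R * x i"] by linarith
    qed
    finally show "multiplicity_at n ?P x \<le> ennreal M" .
  qed
qed

section \<open>Small excess in large dimensions\<close>

definition good_covering :: "nat \<Rightarrow> real \<Rightarrow> bool" where
  "good_covering n e \<longleftrightarrow> (\<exists>P. unit_ball_covering n P \<and>
     covering_density n P \<le> ennreal ((1 / 2 + e) * (real n * ln (real n))) \<and>
     covering_multiplicity n P \<le> ennreal ((xi + e) * (real n * ln (real n))))"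

lemma good_covering_mono:
  assumes "good_covering n e" "e \<le> e'"
  shows "good_covering n e'"
proof -
  have "0 \<le> real n * ln (real n)" by (cases "n = 0") auto
  then have "(1 / 2 + e) * (real n * ln (real n)) \<le> (1 / 2 + e') * (real n * ln (real n))"
    "(xi + e) * (real n * ln (real n)) \<le> (xi + e') * (real n * ln (real n))"
    using assms(2) by (auto intro: mult_right_mono)
  then show ?thesis
    using assms(1) unfolding good_covering_def by (meson ennreal_leI order_trans)
qed

text \<open>Modulus 1 makes every integer point a centre, and a radius above sqrt n ensures
  covering. Density and multiplicity are finite, so a large enough \<open>e\<close> absorbs them,
  since n ln n is positive.\<close>

lemma ex_good_covering:
  assumes n: "2 \<le> n"
  shows "\<exists>e\<ge>0. good_covering n e"
proof -
  define R where "R = sqrt (real n) + 1"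
  have R: "0 < R" "sqrt (real n) \<le> R" by (auto simp: R_def add_nonneg_pos)
  let ?F = "residues 1 n"
  let ?M = "real (card (zball n (\<lambda>_. 0) (R + sqrt (real n))))"
  let ?L = "real n * ln (real n)"
  have L: "0 < ?L" using n by simp
  have phi: "latmap 1 (\<lambda>_. 0) n v \<in> ?F" for v by (rule latmap_in_residues) simp
  have "\<exists>P. unit_ball_covering n P \<and>
    covering_density n P \<le> ennreal (real (card ?F) * (unit_ball_vol (real n) * R ^ n) / real_of_int 1 ^ (n - 1)) \<and>
    covering_multiplicity n P \<le> ennreal ?M"
  proof (rule periodic_covering[where a = "\<lambda>_. 0"])
    fix y
    have "zball n y R \<subseteq> zball n (emb (zfloor n y)) (R + sqrt (real n))"
      using edist_zfloor[of n y] by (intro zball_subset_zball) (simp add: edist_commute)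
    then have "card {v \<in> zball n y R. latmap 1 (\<lambda>_. 0) n v \<in> ?F} \<le> card (zball n (emb (zfloor n y)) (R + sqrt (real n)))"
      by (intro card_mono finite_zball) blast
    then show "real (card {v \<in> zball n y R. latmap 1 (\<lambda>_. 0) n v \<in> ?F}) \<le> ?M"
      by (simp add: card_zball_emb)
    have "zfloor n y \<in> zball n y R"
      using order_trans[OF edist_zfloor R(2)] zfloor_in by (simp only: zball_def mem_Collect_eq simp_thms)
    then show "\<exists>v\<in>zball n y R. latmap 1 (\<lambda>_. 0) n v \<in> ?F" using phi by blast
  qed (use n R in \<open>auto simp: finite_residues\<close>)
  then obtain P where P: "unit_ball_covering n P"
    "covering_density n P \<le> ennreal (unit_ball_vol (real n) * R ^ n)"
    "covering_multiplicity n P \<le> ennreal ?M"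
    by (auto simp: card_residues)
  define e where "e = max (unit_ball_vol (real n) * R ^ n) ?M / ?L"
  have e: "0 \<le> e" using L by (simp add: e_def le_max_iff_disj)
  have eL: "e * ?L = max (unit_ball_vol (real n) * R ^ n) ?M"
    by (rule nonzero_eq_divide_eq[THEN iffD1, OF _ e_def]) (use L in linarith)
  have "0 \<le> xi" using is_xi_bounds[OF is_xi_xi] by linarith
  then have "e * ?L \<le> (1 / 2 + e) * ?L" "e * ?L \<le> (xi + e) * ?L"
    using L by (auto intro!: mult_right_mono)
  then have "unit_ball_vol (real n) * R ^ n \<le> (1 / 2 + e) * ?L" "?M \<le> (xi + e) * ?L"
    using eL by linarith+
  then have "good_covering n e"
    unfolding good_covering_def using P by (meson ennreal_leI order_trans)
  with e show ?thesis by blast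
qed

text \<open>\<open>R > sqrt n\<close> gives \<open>3 * R + sqrt n < 4 * R\<close>, so the ball of
  radius \<open>3 * R\<close> has fewer integer points than the index, as the averaging argument
  needs.\<close>

lemma ex_ball_torus:
  assumes n: "2 \<le> n" and R0: "sqrt (real n) < R0"
  shows "\<exists>p a R. R0 \<le> R \<and> ball_torus n p a R"
proof -
  obtain p R where p: "prime (p :: int)" and R: "R0 \<le> R" "3 * R < real_of_int p"
    and index: "unit_ball_vol (real n) * (4 * R) ^ n = real_of_int p ^ (n - 1)"
    using ex_prime_radius[OF n] by blast
  have p0: "0 < p" using p by (rule prime_gt_0_int)
  have R': "sqrt (real n) < R" "0 < R"
    using R(1) R0 real_sqrt_ge_zero[of "real n"] by linarith+
  have "real (card (zball n (\<lambda>_. 0) (3 * R))) \<le> unit_ball_vol (real n) * (3 * R + sqrt (real n)) ^ n"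
    using n R' by (intro card_zball_le) auto
  also have "\<dots> < unit_ball_vol (real n) * (4 * R) ^ n"
    using n R' by (intro mult_strict_left_mono power_strict_mono) (auto intro: add_nonneg_nonneg)
  also have "\<dots> = real (nat p ^ (n - 1))" using p0 unfolding index by simp
  finally have card: "card (zball n (\<lambda>_. 0) (3 * R)) < nat p ^ (n - 1)" by (simp only: of_nat_less_iff)
  have n0: "0 < n" using n by simp
  obtain a where "\<forall>v\<in>zspace n. \<forall>w\<in>zspace n.
    latmap p a n v = latmap p a n w \<longrightarrow> edist n (emb v) (emb w) \<le> 3 * R \<longrightarrow> v = w"
    using ex_separated_lattice[OF p R(2) n0 card] by blast
  then have "ball_torus n p a R"
    using n p0 R'(2) index by (intro ball_torus.intro) blast+
  with R(1) show ?thesis by blast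
qed

lemma eventually_good_covering:
  assumes \<epsilon>: "0 < \<epsilon>" "\<epsilon> \<le> 1"
  shows "\<forall>\<^sub>F n in sequentially. good_covering n (10 * \<epsilon>)"
proof -
  obtain \<alpha> \<beta> \<gamma> v :: real and k :: "nat \<Rightarrow> real"
    where par: "0 < \<alpha>" "\<alpha> \<le> 1 / 4" "0 < \<beta>" "\<beta> \<le> 1" "0 < \<gamma>" "4 * \<alpha> + \<gamma> + \<beta>\<^sup>2 \<le> 1" "4 * \<beta>\<^sup>2 \<le> \<gamma>\<^sup>2"
    and v: "0 < v" "v \<le> 1"
    and ev: "\<forall>\<^sub>F n in sequentially. \<forall>q. (1 / 2 + \<epsilon>) * (real n * ln (real n)) - 1 \<le> q \<longrightarrow>
      q \<le> (1 / 2 + \<epsilon>) * (real n * ln (real n)) \<longrightarrow>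
      (16 * real n / \<alpha>) ^ n * (exp ((2 * xi - 1) * (q * exp (3 * \<alpha>)))
          / (2 * xi) powr ((xi + 10 * \<epsilon>) * (real n * ln (real n))))
      + (16 * sqrt (real n) / \<beta>) ^ n * (exp (- (1 - v) * (q * (1 - 2 * (4 * \<alpha> + \<gamma> + \<beta>\<^sup>2)))) / v powr k n)
      + (16 * real n / \<alpha>) ^ n * (4 * \<beta>\<^sup>2 / \<gamma>\<^sup>2) powr k n < 1"
    using eventually_union_bound[OF \<epsilon>] by blast
  show ?thesis
    using ev eventually_ge_at_top[of 2]
  proof eventually_elim
    case (elim n)
    have n: "2 \<le> n" by (fact elim(2))
    define L where "L = real n * ln (real n)"
    have L: "0 \<le> L" using n by (simp add: L_def)
    \<comment> \<open>The first two entries keep rounding errors small against the fine and coarse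
      spacings; the third meets the strict bound of \<open>ex_ball_torus\<close>.\<close>
    define R0 where "R0 = Max {4 * real n * sqrt (real n) / \<alpha>, 4 * real n / \<beta>, sqrt (real n) + 1}"
    have "sqrt (real n) + 1 \<le> R0" unfolding R0_def by (rule Max_ge) auto
    then have "sqrt (real n) < R0" by linarith
    then obtain p a R where R_ge: "R0 \<le> R" and torus: "ball_torus n p a R"
      using ex_ball_torus[OF n] by blast
    interpret ball_torus n p a R by (rule torus)
    note R_pos = ball_torus.R[OF torus] and p_pos = ball_torus.p[OF torus] and index = ball_torus.index[OF torus]
    have "4 * real n * sqrt (real n) / \<alpha> \<le> R" "4 * real n / \<beta> \<le> R"
      by (rule order_trans[OF _ R_ge], unfold R0_def, rule Max_ge, simp, simp)+
    then have R\<alpha>: "4 * real n * sqrt (real n) \<le> \<alpha> * R" and R\<beta>: "4 * real n \<le> \<beta> * R"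
      using par by (simp_all add: field_simps)
    define s where "s = w * R ^ n / real (card G)"
    have s: "0 < s" "s \<le> 1"
    proof -
      have "w > 0" by simp
      then have "w \<noteq> 0" by (rule less_imp_neq[THEN not_sym])
      then have "s = 1 / 4 ^ n" using R_pos by (simp add: s_def card_G power_mult_distrib)
      then show "0 < s" "s \<le> 1" by simp_all
    qed
    \<comment> \<open>\<open>s\<close>, equal to 1 / 4^n, is the share of one ball in the torus.
      Rounding \<open>N\<close> down lowers \<open>q\<close> by at most \<open>s\<close>, hence by
      at most 1.\<close>
    define N where "N = nat \<lfloor>(1 / 2 + \<epsilon>) * L / s\<rfloor>"
    define q where "q = real N * (w * R ^ n) / real (card G)"
    have qs: "q = real N * s" by (simp add: q_def s_def)
    have "0 \<le> (1 / 2 + \<epsilon>) * L / s" using L s \<epsilon> by simp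
    then have N: "real N \<le> (1 / 2 + \<epsilon>) * L / s" "(1 / 2 + \<epsilon>) * L / s - 1 \<le> real N"
      unfolding N_def by linarith+
    have q_le: "q \<le> (1 / 2 + \<epsilon>) * L" using N(1) s by (simp add: qs field_simps)
    have "(1 / 2 + \<epsilon>) * L - s \<le> q"
      using mult_right_mono[OF N(2), of s] s by (simp add: qs left_diff_distrib)
    then have q_ge: "(1 / 2 + \<epsilon>) * L - 1 \<le> q" using s(2) by linarith
    have z: "1 \<le> 2 * xi" using is_xi_bounds[OF is_xi_xi] by simp
    obtain F where F: "F \<subseteq> G" "finite F" "card F \<le> N"
      "\<And>y. real (card {v \<in> zball n y R. phi v \<in> F}) \<le> (xi + 10 * \<epsilon>) * L"
      "\<And>y. \<exists>v\<in>zball n y R. phi v \<in> F"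
      using ex_covering_classes[OF par R\<alpha> R\<beta> q_def z v, of "(xi + 10 * \<epsilon>) * L" "k n"] elim(1) q_le q_ge
      unfolding L_def by blast
    obtain P where P: "unit_ball_covering n P"
      "covering_density n P \<le> ennreal (real (card F) * (w * R ^ n) / real_of_int p ^ (n - 1))"
      "covering_multiplicity n P \<le> ennreal ((xi + 10 * \<epsilon>) * L)"
      using periodic_covering[OF _ p_pos R_pos F(2,4,5)] n by auto
    have "real (card F) * (w * R ^ n) / real_of_int p ^ (n - 1) = real (card F) * s"
      using index by (simp add: s_def card_G)
    also have "\<dots> \<le> q" unfolding qs using F(3) s by (intro mult_right_mono) auto
    also have "\<dots> \<le> (1 / 2 + \<epsilon>) * L" by (rule q_le)
    also have "\<dots> \<le> (1 / 2 + 10 * \<epsilon>) * L" using L \<epsilon> by (intro mult_right_mono) auto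
    finally have "covering_density n P \<le> ennreal ((1 / 2 + 10 * \<epsilon>) * L)"
      using P(2) ennreal_leI order_trans by blast
    with P show ?case unfolding good_covering_def L_def by blast
  qed
qed

theorem theorem1p1:
  shows "(\<exists>!x. is_xi x) \<and> 1.79556 \<le> xi \<and> xi < 1.79557 \<and>
    (\<exists>\<epsilon> :: nat \<Rightarrow> real. (\<forall>n. 0 \<le> \<epsilon> n) \<and> \<epsilon> \<longlonglongrightarrow> 0 \<and>
      (\<forall>n\<ge>2. \<exists>P. unit_ball_covering n P \<and>
         covering_density n P \<le> ennreal ((1 / 2 + \<epsilon> n) * (real n * ln (real n))) \<and>
         covering_multiplicity n P \<le> ennreal ((xi + \<epsilon> n) * (real n * ln (real n)))))"
proof -
  define A where "A n = {e. 0 \<le> e \<and> good_covering n e}" for n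
  \<comment> \<open>The infimum of the admissible excesses need not be attained, so 1 / n is added.
    Below dimension 2 the value is a default: n ln n vanishes there.\<close>
  define \<epsilon> where "\<epsilon> n = (if 2 \<le> n then Inf (A n) + 1 / real n else 0)" for n
  have bdd: "bdd_below (A n)" for n by (rule bdd_belowI[of _ 0]) (simp add: A_def)
  have ne: "A n \<noteq> {}" if "2 \<le> n" for n using ex_good_covering[OF that] by (auto simp: A_def)
  have Inf0: "0 \<le> Inf (A n)" if "2 \<le> n" for n
    using ne[OF that] by (intro cInf_greatest) (auto simp: A_def)
  have nonneg: "0 \<le> \<epsilon> n" for n using Inf0 by (simp add: \<epsilon>_def)
  have good: "good_covering n (\<epsilon> n)" if n: "2 \<le> n" for n
  proof -
    have "Inf (A n) < \<epsilon> n" using n by (simp add: \<epsilon>_def)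
    then obtain e where "e \<in> A n" "e < \<epsilon> n" using cInf_lessD[OF ne[OF n]] by blast
    then show ?thesis using good_covering_mono[of n e] by (simp add: A_def)
  qed
  have "\<epsilon> \<longlonglongrightarrow> 0"
  proof (rule order_tendstoI)
    fix y :: real assume "0 < y"
    \<comment> \<open>Half of \<open>y\<close> is reserved for the term 1 / n; the other half bounds
      the excess \<open>10 * d\<close> of \<open>eventually_good_covering\<close>.\<close>
    define d where "d = min 1 (y / 20)"
    have d: "0 < d" "d \<le> 1" "10 * d \<le> y / 2" using \<open>0 < y\<close> by (auto simp: d_def)
    have "\<forall>\<^sub>F n in sequentially. 1 / real n < y / 2"
      using lim_1_over_n[THEN order_tendstoD(2), of "y / 2"] \<open>0 < y\<close> by simp
    then show "\<forall>\<^sub>F n in sequentially. \<epsilon> n < y"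
      using eventually_good_covering[OF d(1,2)] eventually_ge_at_top[of 2]
    proof eventually_elim
      case (elim n)
      have "Inf (A n) \<le> 10 * d"
        using elim(2) d(1) by (intro cInf_lower bdd) (simp add: A_def)
      then show ?case using elim(1,3) d(3) by (simp add: \<epsilon>_def)
    qed
  next
    fix y :: real assume "y < 0"
    then show "\<forall>\<^sub>F n in sequentially. y < \<epsilon> n" using nonneg by (simp add: less_le_trans)
  qed
  then have "\<exists>\<epsilon> :: nat \<Rightarrow> real. (\<forall>n. 0 \<le> \<epsilon> n) \<and> \<epsilon> \<longlonglongrightarrow> 0 \<and> (\<forall>n\<ge>2. good_covering n (\<epsilon> n))"
    using nonneg good by blast
  moreover have "1.79556 \<le> xi" "xi < 1.79557"
    using is_xi_bounds[OF is_xi_xi] by auto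
  ultimately show ?thesis using ex1_is_xi unfolding good_covering_def by blast
qed

end
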